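(* Let $\mathcal{D}_H$ be a left $H$-category and let $(\delta,\sigma)$ be a modular pair in involution for $H$. Then $Z_H^0(\mathcal{D}_H,{^\sigma}{k}_\delta)=HC_H^0(\mathcal{D}_H,{^\sigma}{k}_\delta)$ is in bijection with the $k$-space consisting of $\delta$-invariant $\sigma$-traces on $\mathcal{D}_H$.
   Context: $k$ is a field of characteristic zero; $H$ is a Hopf algebra over $k$ with coproduct $\Delta(h)=h_1\otimes h_2$, counit $\varepsilon$ and bijective antipode $S$. A left $H$-category is a small $k$-linear category $\mathcal D_H$ such that each $Hom_{\mathcal D_H}(X,Y)$ is a left $H$-module, $h(id_X)=\varepsilon(h)id_X$, and $h(gf)=(h_1g)(h_2f)$ for composable $f,g$. Modular pair in involution: $\delta:H\to k$ is an algebra map (character), $\sigma\in H$ is group-like, $\delta(\sigma)=1$, and, with $S_\delta(h)=\delta(h_1)S(h_2)$, one has $S_\delta^2(h)=\sigma h\sigma^{-1}$ for all $h\in H$. A $\sigma$-trace on $\mathcal D_H$ is a collection of $k$-linear maps $T^H_X:Hom_{\mathcal D_H}(X,X)\to k$, $X\in Ob(\mathcal D_H)$, with $T^H_X(g\circ f)=T^H_Y(f\circ(\sigma g))$ for $f\in Hom_{\mathcal D_H}(X,Y)$, $g\in Hom_{\mathcal D_H}(Y,X)$; it is $\delta$-invariant if $T^H_X(hf')=\delta(h)T^H_X(f')$ for all $h\in H$, $f'\in Hom_{\mathcal D_H}(X,X)$. A right-left SAYD (stable anti-Yetter-Drinfeld) module over $H$ is a right $H$-module and left $H$-comodule $M$,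 coaction $m\mapsto m_{(-1)}\otimes m_{(0)}$, with $(mh)_{(-1)}\otimes(mh)_{(0)}=S(h_3)m_{(-1)}h_1\otimes m_{(0)}h_2$ and $m_{(0)}m_{(-1)}=m$. The SAYD module ${^\sigma}k_\delta$ is $k$ with $\alpha\cdot h=\delta(h)\alpha$ and coaction $\alpha\mapsto\sigma\otimes\alpha$. $CN_n(\mathcal D_H)=\bigoplus_{(X_0,\ldots,X_n)} Hom_{\mathcal D_H}(X_1,X_0)\otimes Hom_{\mathcal D_H}(X_2,X_1)\otimes\ldots\otimes Hom_{\mathcal D_H}(X_0,X_n)$, a left $H$-module by the diagonal action. $C^n_H(\mathcal D_H,M)$ is the space of $k$-linear maps $\phi:M\otimes CN_n(\mathcal D_H)\to k$ with $\phi(mh_1\otimes S(h_2)(f^0\otimes\ldots\otimes f^n))=\varepsilon(h)\phi(m\otimes f^0\otimes\ldots\otimes f^n)$. These spaces form a cocyclic module; its cofaces $\delta_i:C^{n-1}_H\to C^n_H$ are $(\delta_i\phi)(m\otimes f^0\otimes\ldots\otimes f^n)=\phi(m\otimes f^0\otimes\ldots\otimes f^if^{i+1}\otimes\ldots\otimes f^n)$ for $0\le i\le n-1$ and $(\delta_n\phi)(m\otimes f^0\otimes\ldots\otimes f^n)=\phi(m_{(0)}\otimes(S^{-1}(m_{(-1)})f^n)f^0\otimes f^1\otimes\ldots\otimes f^{n-1})$. $HC^\bullet_H(\mathcal D_H,M)$ is its cyclic cohomology and $Z^\bullet_H(\mathcal D_H,M)$ its space of cyclic cocycles; in degree $0$,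 $Z^0_H(\mathcal D_H,M)=HC^0_H(\mathcal D_H,M)=Ker(\delta_0-\delta_1:C^0_H(\mathcal D_H,M)\to C^1_H(\mathcal D_H,M))$. *)

theory Defs
  imports Complex_Main "HOL-Library.Poly_Mapping" "HOL-Library.FuncSet"
begin

section \<open>Free vector spaces and tensor products\<close>

text \<open>The type \<open>'x \<Rightarrow>\<^sub>0 'k\<close> is the vector space with basis \<open>'x\<close>.  A tensor product is the quotient
  of the free vector space on tuples by the span of the multilinearity relations.\<close>

definition fscale :: "'k \<Rightarrow> ('x \<Rightarrow>\<^sub>0 'k) \<Rightarrow> ('x \<Rightarrow>\<^sub>0 'k::field)" where
  "fscale a t = Poly_Mapping.map ((*) a) t"

definition gen :: "'x \<Rightarrow> ('x \<Rightarrow>\<^sub>0 'k::field)" where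
  "gen x = Poly_Mapping.single x 1"

text \<open>Linear extension of \<open>F\<close> from basis elements to formal sums.  If \<open>t\<close> is a formal sum
  representing \<open>\<Delta>(h) = h\<^sub>1 \<otimes> h\<^sub>2\<close> and \<open>F\<close> is bilinear, \<open>lin_ext sc (\<lambda>(a, b). F a b) t\<close> is the element
  written \<open>F(h\<^sub>1, h\<^sub>2)\<close> in Sweedler notation.\<close>

definition lin_ext :: "('k \<Rightarrow> 'v \<Rightarrow> 'v) \<Rightarrow> ('x \<Rightarrow> 'v) \<Rightarrow> ('x \<Rightarrow>\<^sub>0 'k::field) \<Rightarrow> 'v::ab_group_add" where
  "lin_ext sc F t = (\<Sum>x\<in>Poly_Mapping.keys t. sc (Poly_Mapping.lookup t x) (F x))"

definition tensor2_relations ::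
  "('k::field \<Rightarrow> 'u \<Rightarrow> 'u) \<Rightarrow> ('k \<Rightarrow> 'v \<Rightarrow> 'v) \<Rightarrow> ('u::ab_group_add \<times> 'v::ab_group_add \<Rightarrow>\<^sub>0 'k) set" where
  "tensor2_relations su sv = module.span fscale
     ({gen (u + u', v) - gen (u, v) - gen (u', v) | u u' v. True}
    \<union> {gen (u, v + v') - gen (u, v) - gen (u, v') | u v v'. True}
    \<union> {gen (su a u, v) - fscale a (gen (u, v)) | a u v. True}
    \<union> {gen (u, sv a v) - fscale a (gen (u, v)) | a u v. True})"

definition tensor3_relations ::
  "('k::field \<Rightarrow> 'u \<Rightarrow> 'u) \<Rightarrow> ('k \<Rightarrow> 'v \<Rightarrow> 'v) \<Rightarrow> ('k \<Rightarrow> 'w \<Rightarrow> 'w) \<Rightarrow>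
   ('u::ab_group_add \<times> 'v::ab_group_add \<times> 'w::ab_group_add \<Rightarrow>\<^sub>0 'k) set" where
  "tensor3_relations su sv sw = module.span fscale
     ({gen (u + u', v, w) - gen (u, v, w) - gen (u', v, w) | u u' v w. True}
    \<union> {gen (u, v + v', w) - gen (u, v, w) - gen (u, v', w) | u v v' w. True}
    \<union> {gen (u, v, w + w') - gen (u, v, w) - gen (u, v, w') | u v w w'. True}
    \<union> {gen (su a u, v, w) - fscale a (gen (u, v, w)) | a u v w. True}
    \<union> {gen (u, sv a v, w) - fscale a (gen (u, v, w)) | a u v w. True}
    \<union> {gen (u, v, sw a w) - fscale a (gen (u, v, w)) | a u v w. True})"

text \<open>Equality of the elements represented by two formal sums in \<open>U \<otimes> V\<close> and in \<open>U \<otimes> V \<otimes> W\<close>.\<close>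

definition eq_tensor2 where
  "eq_tensor2 su sv s t \<longleftrightarrow> s - t \<in> tensor2_relations su sv"

definition eq_tensor3 where
  "eq_tensor3 su sv sw s t \<longleftrightarrow> s - t \<in> tensor3_relations su sv sw"


section \<open>Hopf algebras\<close>

text \<open>The ring structure is that of the type \<open>'h\<close>.  The coproduct of an element of \<open>H\<close> is given by a
  formal sum representing it in \<open>H \<otimes> H\<close>; all axioms only refer to the tensor represented.\<close>

record (overloaded) ('k, 'h) hopf =
  hscale :: "'k \<Rightarrow> 'h \<Rightarrow> 'h"
  comult :: "'h \<Rightarrow> ('h \<times> 'h \<Rightarrow>\<^sub>0 'k)"
  counit :: "'h \<Rightarrow> 'k"
  antipode :: "'h \<Rightarrow> 'h"

abbreviation eqHH :: "('k::field, 'h::ring_1) hopf \<Rightarrow> ('h \<times> 'h \<Rightarrow>\<^sub>0 'k) \<Rightarrow> ('h \<times> 'h \<Rightarrow>\<^sub>0 'k) \<Rightarrow> bool" where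
  "eqHH H \<equiv> eq_tensor2 (hscale H) (hscale H)"

locale hopf_algebra =
  fixes H :: "('k::field, 'h::ring_1) hopf"
  assumes vector_space_H: "vector_space (hscale H)"
    and scale_mult_left: "hscale H a x * y = hscale H a (x * y)"
    and scale_mult_right: "x * hscale H a y = hscale H a (x * y)"
    and comult_add: "eqHH H (comult H (x + y)) (comult H x + comult H y)"
    and comult_scale: "eqHH H (comult H (hscale H a x)) (fscale a (comult H x))"
    and coassoc: "eq_tensor3 (hscale H) (hscale H) (hscale H)
          (lin_ext fscale (\<lambda>(a, b). lin_ext fscale (\<lambda>(a1, a2). gen (a1, a2, b)) (comult H a)) (comult H x))
          (lin_ext fscale (\<lambda>(a, b). lin_ext fscale (\<lambda>(b1, b2). gen (a, b1, b2)) (comult H b)) (comult H x))"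
    and counit_linear: "Vector_Spaces.linear (hscale H) (*) (counit H)"
    and counit_left: "lin_ext (hscale H) (\<lambda>(a, b). hscale H (counit H a) b) (comult H x) = x"
    and counit_right: "lin_ext (hscale H) (\<lambda>(a, b). hscale H (counit H b) a) (comult H x) = x"
    and comult_mult: "eqHH H (comult H (x * y))
          (lin_ext fscale (\<lambda>(a, b). lin_ext fscale (\<lambda>(c, d). gen (a * c, b * d)) (comult H y)) (comult H x))"
    and comult_one: "eqHH H (comult H 1) (gen (1, 1))"
    and counit_mult: "counit H (x * y) = counit H x * counit H y"
    and counit_one: "counit H 1 = 1"
    and antipode_linear: "Vector_Spaces.linear (hscale H) (hscale H) (antipode H)"
    and antipode_left: "lin_ext (hscale H) (\<lambda>(a, b). antipode H a * b) (comult H x) = hscale H (counit H x) 1"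
    and antipode_right: "lin_ext (hscale H) (\<lambda>(a, b). a * antipode H b) (comult H x) = hscale H (counit H x) 1"
    and antipode_bij: "bij (antipode H)"

text \<open>\<open>iter_comult H n h\<close> represents \<open>h\<^sub>1 \<otimes> \<dots> \<otimes> h\<^sub>n\<^sub>+\<^sub>1\<close>, with the tensors \<open>x\<^sub>1 \<otimes> \<dots> \<otimes> x\<^sub>n\<^sub>+\<^sub>1\<close> written as
  lists of length \<open>n + 1\<close>.\<close>

primrec iter_comult :: "('k::field, 'h) hopf \<Rightarrow> nat \<Rightarrow> 'h \<Rightarrow> ('h list \<Rightarrow>\<^sub>0 'k)" where
  "iter_comult H 0 h = gen [h]"
| "iter_comult H (Suc n) h =
     lin_ext fscale (\<lambda>(a, b). lin_ext fscale (\<lambda>cs. gen (a # cs)) (iter_comult H n b)) (comult H h)"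


section \<open>Modular pairs in involution\<close>

definition character :: "('k::field, 'h::ring_1) hopf \<Rightarrow> ('h \<Rightarrow> 'k) \<Rightarrow> bool" where
  "character H \<delta> \<longleftrightarrow> Vector_Spaces.linear (hscale H) (*) \<delta> \<and> (\<forall>x y. \<delta> (x * y) = \<delta> x * \<delta> y) \<and> \<delta> 1 = 1"

definition group_like :: "('k::field, 'h::ring_1) hopf \<Rightarrow> 'h \<Rightarrow> bool" where
  "group_like H \<sigma> \<longleftrightarrow> eqHH H (comult H \<sigma>) (gen (\<sigma>, \<sigma>)) \<and> counit H \<sigma> = 1"

definition twisted_antipode :: "('k::field, 'h::ring_1) hopf \<Rightarrow> ('h \<Rightarrow> 'k) \<Rightarrow> 'h \<Rightarrow> 'h" where
  "twisted_antipode H \<delta> h = lin_ext (hscale H) (\<lambda>(a, b). hscale H (\<delta> a) (antipode H b)) (comult H h)"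

text \<open>The element \<open>\<sigma>'\<close> below is the two-sided inverse of \<open>\<sigma>\<close>.\<close>

definition modular_pair_in_involution :: "('k::field, 'h::ring_1) hopf \<Rightarrow> ('h \<Rightarrow> 'k) \<Rightarrow> 'h \<Rightarrow> bool" where
  "modular_pair_in_involution H \<delta> \<sigma> \<longleftrightarrow> character H \<delta> \<and> group_like H \<sigma> \<and> \<delta> \<sigma> = 1 \<and>
     (\<exists>\<sigma>'. \<sigma> * \<sigma>' = 1 \<and> \<sigma>' * \<sigma> = 1 \<and>
       (\<forall>h. twisted_antipode H \<delta> (twisted_antipode H \<delta> h) = \<sigma> * h * \<sigma>'))"


section \<open>Coefficients\<close>

text \<open>A vector space with a right \<open>H\<close>-action and a left \<open>H\<close>-coaction, the coaction being given by
  representing formal sums in \<open>H \<otimes> M\<close>.  The formulas for the cochain spaces and cofaces below only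
  use these data; the SAYD axioms are not imposed, as the only coefficients in the theorem are those
  of \<open>sigma_k_delta\<close>, where they follow from \<open>(\<delta>, \<sigma>)\<close> being a modular pair in involution.\<close>

record (overloaded) ('k, 'h, 'v) mod_comod =
  vscale :: "'k \<Rightarrow> 'v \<Rightarrow> 'v"
  ract :: "'v \<Rightarrow> 'h \<Rightarrow> 'v"
  coact :: "'v \<Rightarrow> ('h \<times> 'v \<Rightarrow>\<^sub>0 'k)"

definition sigma_k_delta :: "'h \<Rightarrow> ('h \<Rightarrow> 'k::field) \<Rightarrow> ('k, 'h, 'k) mod_comod" where
  "sigma_k_delta \<sigma> \<delta> = \<lparr>vscale = (*), ract = (\<lambda>\<alpha> h. \<delta> h * \<alpha>), coact = (\<lambda>\<alpha>. gen (\<sigma>, \<alpha>))\<rparr>"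


section \<open>Left \<open>H\<close>-categories\<close>

text \<open>The morphism spaces are subspaces of one vector space \<open>'m\<close>, for instance of the direct sum of all
  of them; they may overlap, so all operations carry their objects as arguments.
  For \<open>f : X \<rightarrow> Y\<close> and \<open>g : Y \<rightarrow> Z\<close> the composite \<open>g \<circ> f\<close> is \<open>cmp D X Y Z g f\<close>.\<close>

record ('k, 'h, 'o, 'm) hcat =
  Ob :: "'o set"
  Hom :: "'o \<Rightarrow> 'o \<Rightarrow> 'm set"
  mscale :: "'k \<Rightarrow> 'm \<Rightarrow> 'm"
  cmp :: "'o \<Rightarrow> 'o \<Rightarrow> 'o \<Rightarrow> 'm \<Rightarrow> 'm \<Rightarrow> 'm"
  idm :: "'o \<Rightarrow> 'm"
  act :: "'o \<Rightarrow> 'o \<Rightarrow> 'h \<Rightarrow> 'm \<Rightarrow> 'm"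

locale linear_category =
  fixes D :: "('k::field, 'h, 'o, 'm::ab_group_add) hcat"
  assumes vector_space_D: "vector_space (mscale D)"
    and subspace_Hom: "X \<in> Ob D \<Longrightarrow> Y \<in> Ob D \<Longrightarrow> module.subspace (mscale D) (Hom D X Y)"
    and cmp_closed: "X \<in> Ob D \<Longrightarrow> Y \<in> Ob D \<Longrightarrow> Z \<in> Ob D \<Longrightarrow> g \<in> Hom D Y Z \<Longrightarrow> f \<in> Hom D X Y \<Longrightarrow>
          cmp D X Y Z g f \<in> Hom D X Z"
    and cmp_add_left: "X \<in> Ob D \<Longrightarrow> Y \<in> Ob D \<Longrightarrow> Z \<in> Ob D \<Longrightarrow>
          g \<in> Hom D Y Z \<Longrightarrow> g' \<in> Hom D Y Z \<Longrightarrow> f \<in> Hom D X Y \<Longrightarrow>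
          cmp D X Y Z (g + g') f = cmp D X Y Z g f + cmp D X Y Z g' f"
    and cmp_add_right: "X \<in> Ob D \<Longrightarrow> Y \<in> Ob D \<Longrightarrow> Z \<in> Ob D \<Longrightarrow>
          g \<in> Hom D Y Z \<Longrightarrow> f \<in> Hom D X Y \<Longrightarrow> f' \<in> Hom D X Y \<Longrightarrow>
          cmp D X Y Z g (f + f') = cmp D X Y Z g f + cmp D X Y Z g f'"
    and cmp_scale_left: "X \<in> Ob D \<Longrightarrow> Y \<in> Ob D \<Longrightarrow> Z \<in> Ob D \<Longrightarrow> g \<in> Hom D Y Z \<Longrightarrow> f \<in> Hom D X Y \<Longrightarrow>
          cmp D X Y Z (mscale D a g) f = mscale D a (cmp D X Y Z g f)"
    and cmp_scale_right: "X \<in> Ob D \<Longrightarrow> Y \<in> Ob D \<Longrightarrow> Z \<in> Ob D \<Longrightarrow> g \<in> Hom D Y Z \<Longrightarrow> f \<in> Hom D X Y \<Longrightarrow>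
          cmp D X Y Z g (mscale D a f) = mscale D a (cmp D X Y Z g f)"
    and cmp_assoc: "W \<in> Ob D \<Longrightarrow> X \<in> Ob D \<Longrightarrow> Y \<in> Ob D \<Longrightarrow> Z \<in> Ob D \<Longrightarrow>
          h \<in> Hom D Y Z \<Longrightarrow> g \<in> Hom D X Y \<Longrightarrow> f \<in> Hom D W X \<Longrightarrow>
          cmp D W X Z (cmp D X Y Z h g) f = cmp D W Y Z h (cmp D W X Y g f)"
    and idm_closed: "X \<in> Ob D \<Longrightarrow> idm D X \<in> Hom D X X"
    and cmp_idm_left: "X \<in> Ob D \<Longrightarrow> Y \<in> Ob D \<Longrightarrow> f \<in> Hom D X Y \<Longrightarrow> cmp D X Y Y (idm D Y) f = f"
    and cmp_idm_right: "X \<in> Ob D \<Longrightarrow> Y \<in> Ob D \<Longrightarrow> f \<in> Hom D X Y \<Longrightarrow> cmp D X X Y f (idm D X) = f"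

locale left_H_category = hopf_algebra H + linear_category D
  for H :: "('k::field, 'h::ring_1) hopf" and D :: "('k, 'h, 'o, 'm::ab_group_add) hcat" +
  assumes act_closed: "X \<in> Ob D \<Longrightarrow> Y \<in> Ob D \<Longrightarrow> f \<in> Hom D X Y \<Longrightarrow> act D X Y h f \<in> Hom D X Y"
    and act_add: "X \<in> Ob D \<Longrightarrow> Y \<in> Ob D \<Longrightarrow> f \<in> Hom D X Y \<Longrightarrow> f' \<in> Hom D X Y \<Longrightarrow>
          act D X Y h (f + f') = act D X Y h f + act D X Y h f'"
    and act_scale: "X \<in> Ob D \<Longrightarrow> Y \<in> Ob D \<Longrightarrow> f \<in> Hom D X Y \<Longrightarrow>
          act D X Y h (mscale D a f) = mscale D a (act D X Y h f)"
    and act_H_add: "X \<in> Ob D \<Longrightarrow> Y \<in> Ob D \<Longrightarrow> f \<in> Hom D X Y \<Longrightarrow>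
          act D X Y (h + h') f = act D X Y h f + act D X Y h' f"
    and act_H_scale: "X \<in> Ob D \<Longrightarrow> Y \<in> Ob D \<Longrightarrow> f \<in> Hom D X Y \<Longrightarrow>
          act D X Y (hscale H a h) f = mscale D a (act D X Y h f)"
    and act_H_one: "X \<in> Ob D \<Longrightarrow> Y \<in> Ob D \<Longrightarrow> f \<in> Hom D X Y \<Longrightarrow> act D X Y 1 f = f"
    and act_H_mult: "X \<in> Ob D \<Longrightarrow> Y \<in> Ob D \<Longrightarrow> f \<in> Hom D X Y \<Longrightarrow>
          act D X Y (h * h') f = act D X Y h (act D X Y h' f)"
    and act_idm: "X \<in> Ob D \<Longrightarrow> act D X X h (idm D X) = mscale D (counit H h) (idm D X)"
    and act_cmp: "X \<in> Ob D \<Longrightarrow> Y \<in> Ob D \<Longrightarrow> Z \<in> Ob D \<Longrightarrow> g \<in> Hom D Y Z \<Longrightarrow> f \<in> Hom D X Y \<Longrightarrow>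
          act D X Z h (cmp D X Y Z g f) =
          lin_ext (mscale D) (\<lambda>(a, b). cmp D X Y Z (act D Y Z a g) (act D X Y b f)) (comult H h)"

text \<open>A linear functional on a subspace \<open>V\<close>, extensional so that it is determined by its values on \<open>V\<close>.\<close>

definition functionals_on :: "('k::field \<Rightarrow> 'm \<Rightarrow> 'm) \<Rightarrow> 'm::ab_group_add set \<Rightarrow> ('m \<Rightarrow> 'k) set" where
  "functionals_on sc V = {t \<in> extensional V.
     (\<forall>x\<in>V. \<forall>y\<in>V. t (x + y) = t x + t y) \<and> (\<forall>a. \<forall>x\<in>V. t (sc a x) = a * t x)}"

definition sigma_traces ::
  "('k::field, 'h, 'o, 'm::ab_group_add) hcat \<Rightarrow> 'h \<Rightarrow> ('o \<Rightarrow> 'm \<Rightarrow> 'k) set" where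
  "sigma_traces D \<sigma> = {T \<in> (\<Pi>\<^sub>E X\<in>Ob D. functionals_on (mscale D) (Hom D X X)).
     \<forall>X\<in>Ob D. \<forall>Y\<in>Ob D. \<forall>f\<in>Hom D X Y. \<forall>g\<in>Hom D Y X.
       T X (cmp D X Y X g f) = T Y (cmp D Y X Y f (act D Y X \<sigma> g))}"

definition invariant_sigma_traces ::
  "('k::field, 'h, 'o, 'm::ab_group_add) hcat \<Rightarrow> ('h \<Rightarrow> 'k) \<Rightarrow> 'h \<Rightarrow> ('o \<Rightarrow> 'm \<Rightarrow> 'k) set" where
  "invariant_sigma_traces D \<delta> \<sigma> = {T \<in> sigma_traces D \<sigma>.
     \<forall>X\<in>Ob D. \<forall>h. \<forall>f\<in>Hom D X X. T X (act D X X h f) = \<delta> h * T X f}"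


section \<open>The Hopf-cyclic cochains\<close>

text \<open>The space \<open>M \<otimes> CN\<^sub>n(D)\<close> is the quotient of the free vector space on the set of all
  \<open>(m, [X\<^sub>0,\<dots>,X\<^sub>n], [f\<^sup>0,\<dots>,f\<^sup>n])\<close> with \<open>f\<^sup>i : X\<^sub>i\<^sub>+\<^sub>1 \<rightarrow> X\<^sub>i\<close> (indices modulo \<open>n + 1\<close>) by the relations of
  multilinearity in \<open>m\<close> and the \<open>f\<^sup>i\<close>; keeping the objects in the generators
  gives the direct sum over all \<open>(X\<^sub>0,\<dots>,X\<^sub>n)\<close>.\<close>

definition cn_tuples :: "('k, 'h, 'o, 'm) hcat \<Rightarrow> nat \<Rightarrow> ('v \<times> 'o list \<times> 'm list) set" where
  "cn_tuples D n = {(m, Xs, fs). length Xs = Suc n \<and> length fs = Suc n \<and> set Xs \<subseteq> Ob D \<and>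
     (\<forall>i\<le>n. fs ! i \<in> Hom D (Xs ! (Suc i mod Suc n)) (Xs ! i))}"

definition cn_free :: "('k::field, 'h, 'o, 'm) hcat \<Rightarrow> nat \<Rightarrow> ('v \<times> 'o list \<times> 'm list \<Rightarrow>\<^sub>0 'k) set" where
  "cn_free D n = {t. Poly_Mapping.keys t \<subseteq> cn_tuples D n}"

definition cn_relations ::
  "('k::field, 'h, 'o, 'm::ab_group_add) hcat \<Rightarrow> ('k, 'h, 'v::ab_group_add) mod_comod \<Rightarrow> nat \<Rightarrow>
   ('v \<times> 'o list \<times> 'm list \<Rightarrow>\<^sub>0 'k) set" where
  "cn_relations D M n = module.span fscale
     ({gen (m + m', Xs, fs) - gen (m, Xs, fs) - gen (m', Xs, fs) | m m' Xs fs. (m, Xs, fs) \<in> cn_tuples D n}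
    \<union> {gen (vscale M a m, Xs, fs) - fscale a (gen (m, Xs, fs)) | a m Xs fs. (m, Xs, fs) \<in> cn_tuples D n}
    \<union> {gen (m, Xs, fs[i := f + f']) - gen (m, Xs, fs[i := f]) - gen (m, Xs, fs[i := f']) | m Xs fs i f f'.
         i \<le> n \<and> (m, Xs, fs[i := f]) \<in> cn_tuples D n \<and> (m, Xs, fs[i := f']) \<in> cn_tuples D n}
    \<union> {gen (m, Xs, fs[i := mscale D a f]) - fscale a (gen (m, Xs, fs[i := f])) | a m Xs fs i f.
         i \<le> n \<and> (m, Xs, fs[i := f]) \<in> cn_tuples D n})"

definition cn_class where
  "cn_class D M n t = {s. s - t \<in> cn_relations D M n}"

definition cn_tensor ::
  "('k::field, 'h, 'o, 'm::ab_group_add) hcat \<Rightarrow> ('k, 'h, 'v::ab_group_add) mod_comod \<Rightarrow> nat \<Rightarrow>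
   ('v \<times> 'o list \<times> 'm list \<Rightarrow>\<^sub>0 'k) set set" where
  "cn_tensor D M n = cn_class D M n ` cn_free D n"

text \<open>The element \<open>m \<otimes> f\<^sup>0 \<otimes> \<dots> \<otimes> f\<^sup>n\<close> of \<open>M \<otimes> CN\<^sub>n(D)\<close>.\<close>

definition pure where
  "pure D M n m Xs fs = cn_class D M n (gen (m, Xs, fs))"

definition cn_functionals ::
  "('k::field, 'h, 'o, 'm::ab_group_add) hcat \<Rightarrow> ('k, 'h, 'v::ab_group_add) mod_comod \<Rightarrow> nat \<Rightarrow>
   (('v \<times> 'o list \<times> 'm list \<Rightarrow>\<^sub>0 'k) set \<Rightarrow> 'k) set" where
  "cn_functionals D M n = {\<phi> \<in> extensional (cn_tensor D M n).
     (\<forall>s\<in>cn_free D n. \<forall>t\<in>cn_free D n.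
        \<phi> (cn_class D M n (s + t)) = \<phi> (cn_class D M n s) + \<phi> (cn_class D M n t)) \<and>
     (\<forall>a. \<forall>t\<in>cn_free D n. \<phi> (cn_class D M n (fscale a t)) = a * \<phi> (cn_class D M n t))}"

text \<open>The tuple \<open>(c\<^sub>0 f\<^sup>0, \<dots>, c\<^sub>n f\<^sup>n)\<close>.\<close>

definition act_tuple ::
  "('k, 'h, 'o, 'm) hcat \<Rightarrow> nat \<Rightarrow> 'o list \<Rightarrow> 'h list \<Rightarrow> 'm list \<Rightarrow> 'm list" where
  "act_tuple D n Xs cs fs = map (\<lambda>i. act D (Xs ! (Suc i mod Suc n)) (Xs ! i) (cs ! i) (fs ! i)) [0..<Suc n]"

text \<open>\<open>C\<^sup>n\<^sub>H(D, M)\<close>.\<close>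

definition cochains ::
  "('k::field, 'h::ring_1) hopf \<Rightarrow> ('k, 'h, 'o, 'm::ab_group_add) hcat \<Rightarrow>
   ('k, 'h, 'v::ab_group_add) mod_comod \<Rightarrow> nat \<Rightarrow> (('v \<times> 'o list \<times> 'm list \<Rightarrow>\<^sub>0 'k) set \<Rightarrow> 'k) set" where
  "cochains H D M n = {\<phi> \<in> cn_functionals D M n.
     \<forall>h. \<forall>(m, Xs, fs) \<in> cn_tuples D n.
       lin_ext (*) (\<lambda>(h1, h2). lin_ext (*) (\<lambda>cs. \<phi> (pure D M n (ract M m h1) Xs (act_tuple D n Xs cs fs)))
                               (iter_comult H n (antipode H h2))) (comult H h)
       = counit H h * \<phi> (pure D M n m Xs fs)}"

text \<open>The value of \<open>\<delta>\<^sub>i \<phi>\<close> at \<open>m \<otimes> f\<^sup>0 \<otimes> \<dots> \<otimes> f\<^sup>n\<close>, for \<open>\<phi>\<close> of degree \<open>n - 1\<close>, \<open>n \<ge> 1\<close> and \<open>i \<le> n\<close>: the objects of the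
  product are \<open>X\<^sub>0,\<dots>,X\<^sub>i,X\<^sub>i\<^sub>+\<^sub>2,\<dots>,X\<^sub>n\<close> if \<open>i < n\<close>, and \<open>X\<^sub>n,X\<^sub>1,\<dots>,X\<^sub>n\<^sub>-\<^sub>1\<close> if \<open>i = n\<close>.\<close>

definition coface_value where
  "coface_value H D M n i \<phi> = (\<lambda>(m, Xs, fs).
     if i < n then
       \<phi> (pure D M (n - 1) m (take (Suc i) Xs @ drop (i + 2) Xs)
            (take i fs @ cmp D (Xs ! ((i + 2) mod Suc n)) (Xs ! Suc i) (Xs ! i) (fs ! i) (fs ! Suc i)
               # drop (i + 2) fs))
     else
       lin_ext (*) (\<lambda>(a, m'). \<phi> (pure D M (n - 1) m' (Xs ! n # take (n - 1) (drop 1 Xs))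
            (cmp D (Xs ! 1) (Xs ! 0) (Xs ! n) (act D (Xs ! 0) (Xs ! n) (inv (antipode H) a) (fs ! n)) (fs ! 0)
               # take (n - 1) (drop 1 fs)))) (coact M m))"

text \<open>\<open>\<delta>\<^sub>i \<phi>\<close> is the linear extension of these values, computed on a chosen representative of a class in
  \<open>M \<otimes> CN\<^sub>n(D)\<close>; the values are multilinear when \<open>\<phi>\<close> is a cochain,
  so that the choice is immaterial.\<close>

definition coface ::
  "('k::field, 'h::ring_1) hopf \<Rightarrow> ('k, 'h, 'o, 'm::ab_group_add) hcat \<Rightarrow>
   ('k, 'h, 'v::ab_group_add) mod_comod \<Rightarrow> nat \<Rightarrow> nat \<Rightarrow>
   (('v \<times> 'o list \<times> 'm list \<Rightarrow>\<^sub>0 'k) set \<Rightarrow> 'k) \<Rightarrow> (('v \<times> 'o list \<times> 'm list \<Rightarrow>\<^sub>0 'k) set \<Rightarrow> 'k)" where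
  "coface H D M n i \<phi> = (\<lambda>C\<in>cn_tensor D M n. lin_ext (*) (coface_value H D M n i \<phi>) (SOME t. t \<in> C))"

text \<open>\<open>Z\<^sup>0\<^sub>H(D, M) = HC\<^sup>0\<^sub>H(D, M) = Ker(\<delta>\<^sub>0 - \<delta>\<^sub>1 : C\<^sup>0\<^sub>H(D, M) \<rightarrow> C\<^sup>1\<^sub>H(D, M))\<close>; there are no coboundaries in
  degree \<open>0\<close>.\<close>

definition HC0 ::
  "('k::field, 'h::ring_1) hopf \<Rightarrow> ('k, 'h, 'o, 'm::ab_group_add) hcat \<Rightarrow>
   ('k, 'h, 'v::ab_group_add) mod_comod \<Rightarrow> (('v \<times> 'o list \<times> 'm list \<Rightarrow>\<^sub>0 'k) set \<Rightarrow> 'k) set" where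
  "HC0 H D M = {\<phi> \<in> cochains H D M 0. \<forall>C\<in>cn_tensor D M 1. coface H D M 1 0 \<phi> C - coface H D M 1 1 \<phi> C = 0}"

end

theory Submission
  imports Defs
begin

text \<open>A functional on \<open>k \<otimes> CN\<^sub>0(D)\<close> is a family of functionals \<open>T\<^sub>X\<close> on the endomorphism spaces.  Equivariance
  says \<open>T(S\<^sub>\<delta>(h) f) = \<epsilon>(h) T(f)\<close>.  As \<open>\<epsilon> \<circ> S\<^sub>\<delta> = \<delta>\<close>, applying this twice gives \<open>T(\<sigma> h \<sigma>\<inverse> f) = \<delta>(h) T(f)\<close>,
  hence \<open>\<delta>\<close>-invariance; the converse is \<open>\<delta> \<circ> S\<^sub>\<delta> = \<epsilon>\<close>.  Since \<open>S\<inverse>(\<sigma>) = \<sigma>\<inverse>\<close>, vanishing of \<open>\<delta>\<^sub>0 - \<delta>\<^sub>1\<close> says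
  \<open>T(g f) = T((\<sigma>\<inverse> f) g)\<close>, and \<open>\<delta>\<close>-invariance under the group-like \<open>\<sigma>\<close> turns the right-hand side into
  \<open>T(f (\<sigma> g))\<close>.\<close>

section \<open>Linear extension\<close>

lemma lookup_fscale: "Poly_Mapping.lookup (fscale a t) x = a * Poly_Mapping.lookup t x"
  by (simp add: fscale_def map.rep_eq when_def)

lemma vector_space_fscale: "vector_space fscale"
  by unfold_locales (auto intro!: poly_mapping_eqI simp: lookup_fscale lookup_add algebra_simps)

lemma vector_space_times: "vector_space ((*) :: 'k::field \<Rightarrow> 'k \<Rightarrow> 'k)"
  by unfold_locales (auto simp: algebra_simps)

lemma vector_space_linearI:
  assumes "vector_space s1" "vector_space s2"
    and "\<And>x y. f (x + y) = f x + f y" "\<And>a x. f (s1 a x) = s2 a (f x)"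
  shows "Vector_Spaces.linear s1 s2 f"
  using assms unfolding Vector_Spaces.linear_iff by blast

text \<open>Coefficients can cancel in a sum, so \<open>keys\<close> is not additive. Over a common
  finite superset the extra terms have coefficient 0, and two formal sums can be compared
  termwise.\<close>

lemma lin_ext_superset:
  assumes "vector_space sc" "finite A" "Poly_Mapping.keys t \<subseteq> A"
  shows "lin_ext sc F t = (\<Sum>x\<in>A. sc (Poly_Mapping.lookup t x) (F x))"
proof -
  interpret vector_space sc by fact
  show ?thesis
    unfolding lin_ext_def using assms(2,3)
    by (intro sum.mono_neutral_left) (auto simp: in_keys_iff)
qed

lemma linear_lin_ext:
  fixes F :: "'x \<Rightarrow> 'v::ab_group_add" and sc :: "'k::field \<Rightarrow> 'v \<Rightarrow> 'v"
  assumes "vector_space sc"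
  shows "Vector_Spaces.linear fscale sc (lin_ext sc F)"
proof -
  interpret vector_space sc by fact
  show ?thesis
  proof (rule vector_space_linearI[OF vector_space_fscale assms])
    fix s t :: "'x \<Rightarrow>\<^sub>0 'k"
    let ?A = "Poly_Mapping.keys s \<union> Poly_Mapping.keys t"
    have "Poly_Mapping.keys (s + t) \<subseteq> ?A"
      by (rule keys_add)
    then show "lin_ext sc F (s + t) = lin_ext sc F s + lin_ext sc F t"
      by (simp add: lin_ext_superset[OF assms, where A = ?A] lookup_add scale_left_distrib sum.distrib)
  next
    fix a and t :: "'x \<Rightarrow>\<^sub>0 'k"
    have "Poly_Mapping.keys (fscale a t) \<subseteq> Poly_Mapping.keys t"
      by (auto simp: in_keys_iff lookup_fscale)
    then show "lin_ext sc F (fscale a t) = sc a (lin_ext sc F t)"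
      by (simp add: lin_ext_superset[OF assms, where A = "Poly_Mapping.keys t"] lookup_fscale scale_sum_right)
  qed
qed

lemma
  assumes "vector_space sc"
  shows lin_ext_add: "lin_ext sc F (s + t) = lin_ext sc F s + lin_ext sc F t"
    and lin_ext_diff: "lin_ext sc F (s - t) = lin_ext sc F s - lin_ext sc F t"
    and lin_ext_fscale: "lin_ext sc F (fscale a t) = sc a (lin_ext sc F t)"
proof -
  interpret Vector_Spaces.linear fscale sc "lin_ext sc F"
    by (rule linear_lin_ext) fact
  show "lin_ext sc F (s + t) = lin_ext sc F s + lin_ext sc F t"
    and "lin_ext sc F (s - t) = lin_ext sc F s - lin_ext sc F t"
    and "lin_ext sc F (fscale a t) = sc a (lin_ext sc F t)"
    by (rule add diff scale)+
qed

lemma lin_ext_gen: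
  assumes "vector_space sc"
  shows "lin_ext sc F (gen x) = F x"
proof -
  interpret vector_space sc by fact
  show ?thesis by (simp add: lin_ext_def gen_def)
qed

lemma linear_lin_ext_eq:
  assumes "Vector_Spaces.linear s1 s2 G"
  shows "G (lin_ext s1 F t) = lin_ext s2 (\<lambda>x. G (F x)) t"
proof -
  interpret Vector_Spaces.linear s1 s2 G by fact
  show ?thesis by (simp add: lin_ext_def sum scale)
qed

text \<open>For nested Sweedler sums: the inner sum is linear in a leg of the outer coproduct as
  soon as each of its terms is.\<close>

lemma linear_lin_ext_family:
  assumes vs: "vector_space s1" "vector_space s2"
    and lin: "\<And>x. Vector_Spaces.linear s1 s2 (\<lambda>u. G u x)"
  shows "Vector_Spaces.linear s1 s2 (\<lambda>u. lin_ext s2 (G u) t)"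
proof -
  interpret v2: vector_space s2 by fact
  interpret l: Vector_Spaces.linear s1 s2 "\<lambda>u. G u x" for x by (rule lin)
  show ?thesis
  proof (rule vector_space_linearI[OF vs])
    fix a u
    show "lin_ext s2 (G (s1 a u)) t = s2 a (lin_ext s2 (G u) t)"
      unfolding lin_ext_def l.scale v2.scale_sum_right by (intro sum.cong refl v2.scale_left_commute)
  qed (simp add: lin_ext_def l.add v2.scale_right_distrib sum.distrib)
qed

lemma lin_ext_cong_keys:
  assumes "\<And>x. x \<in> Poly_Mapping.keys t \<Longrightarrow> F x = G x"
  shows "lin_ext sc F t = lin_ext sc G t"
  unfolding lin_ext_def using assms by (intro sum.cong) auto

lemma lin_ext_span_eq_0:
  assumes "vector_space sc" "t \<in> module.span fscale S" "\<And>s. s \<in> S \<Longrightarrow> lin_ext sc F s = 0"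
  shows "lin_ext sc F t = 0"
proof -
  interpret Vector_Spaces.linear fscale sc "lin_ext sc F"
    by (rule linear_lin_ext) fact
  show ?thesis using eq_0_on_span assms(2,3) by blast
qed

text \<open>The universal property of the tensor product: a bilinear F kills the four families of
  relations, so its extension depends only on the tensor represented. Hopf axioms stated with
  \<open>eq_tensor2\<close> are applied through it.\<close>

lemma lin_ext_eq_tensor2:
  assumes lin1: "\<And>v. Vector_Spaces.linear su sc (\<lambda>u. F (u, v))"
    and lin2: "\<And>u. Vector_Spaces.linear sv sc (\<lambda>v. F (u, v))"
    and eq: "eq_tensor2 su sv s t"
  shows "lin_ext sc F s = lin_ext sc F t"
proof -
  interpret l1: Vector_Spaces.linear su sc "\<lambda>u. F (u, v)" for v by (rule lin1)
  interpret l2: Vector_Spaces.linear sv sc "\<lambda>v. F (u, v)" for u by (rule lin2)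
  note vs = l1.vs2.vector_space_axioms
  have "lin_ext sc F (s - t) = 0"
    using eq unfolding eq_tensor2_def tensor2_relations_def
    by (rule lin_ext_span_eq_0[OF vs])
       (auto simp: lin_ext_diff[OF vs] lin_ext_fscale[OF vs] lin_ext_gen[OF vs]
          l1.add l1.scale l2.add l2.scale)
  then show ?thesis by (simp add: lin_ext_diff[OF vs])
qed

section \<open>Hopf algebras and modular pairs\<close>

context hopf_algebra
begin

sublocale H: vector_space "hscale H" by (rule vector_space_H)

lemma linear_mult_left: "Vector_Spaces.linear (hscale H) (hscale H) (\<lambda>x. x * y)"
  by (rule vector_space_linearI[OF vector_space_H vector_space_H]) (auto simp: distrib_right scale_mult_left)

text \<open>Apply \<epsilon> to S(x_1) x_2 = \<epsilon>(x) 1. By linearity \<epsilon>(S(x_1))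
  \<epsilon>(x_2) equals \<epsilon>(S(x_1 \<epsilon>(x_2))), which the counit axiom reduces to
  \<epsilon>(S(x)).\<close>

lemma counit_antipode: "counit H (antipode H x) = counit H x"
proof -
  interpret c: Vector_Spaces.linear "hscale H" "(*)" "counit H" by (rule counit_linear)
  interpret s: Vector_Spaces.linear "hscale H" "hscale H" "antipode H" by (rule antipode_linear)
  have "counit H x = counit H (lin_ext (hscale H) (\<lambda>(a, b). antipode H a * b) (comult H x))"
    by (simp add: antipode_left c.scale counit_one)
  also have "\<dots> = lin_ext (*) (\<lambda>(a, b). counit H (antipode H a) * counit H b) (comult H x)"
    by (simp add: linear_lin_ext_eq[OF counit_linear] case_prod_unfold counit_mult)
  also have "\<dots> = counit H (antipode H (lin_ext (hscale H) (\<lambda>(a, b). hscale H (counit H b) a) (comult H x)))"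
    by (simp add: linear_lin_ext_eq[OF counit_linear] linear_lin_ext_eq[OF antipode_linear]
        case_prod_unfold s.scale c.scale mult.commute)
  finally show ?thesis by (simp add: counit_right)
qed

text \<open>Since \<epsilon> is invariant under S, both sides equal \<delta>(x_1) \<epsilon>(x_2);
  on the right this is \<delta> applied to the counit axiom.\<close>

lemma counit_twisted_antipode:
  assumes "character H \<delta>"
  shows "counit H (twisted_antipode H \<delta> x) = \<delta> x"
proof -
  have \<delta>: "Vector_Spaces.linear (hscale H) (*) \<delta>" using assms by (simp add: character_def)
  interpret c: Vector_Spaces.linear "hscale H" "(*)" "counit H" by (rule counit_linear)
  interpret d: Vector_Spaces.linear "hscale H" "(*)" \<delta> by (rule \<delta>)
  have "\<delta> x = \<delta> (lin_ext (hscale H) (\<lambda>(a, b). hscale H (counit H b) a) (comult H x))"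
    by (simp add: counit_right)
  then show ?thesis
    by (simp add: twisted_antipode_def linear_lin_ext_eq[OF counit_linear] linear_lin_ext_eq[OF \<delta>]
        case_prod_unfold c.scale d.scale counit_antipode mult.commute)
qed

lemma lin_ext_comult_group_like:
  assumes "group_like H g"
    and "\<And>v. Vector_Spaces.linear (hscale H) sc (\<lambda>u. F (u, v))"
    and "\<And>u. Vector_Spaces.linear (hscale H) sc (\<lambda>v. F (u, v))"
  shows "lin_ext sc F (comult H g) = F (g, g)"
proof -
  have "vector_space sc"
    using assms(2) by (simp add: Vector_Spaces.linear_def module_hom_iff)
  moreover have "lin_ext sc F (comult H g) = lin_ext sc F (gen (g, g))"
    using assms by (intro lin_ext_eq_tensor2) (auto simp: group_like_def)
  ultimately show ?thesis by (simp add: lin_ext_gen)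
qed

lemma lin_ext_comult_mult:
  assumes lin1: "\<And>v. Vector_Spaces.linear (hscale H) sc (\<lambda>u. F (u, v))"
    and lin2: "\<And>u. Vector_Spaces.linear (hscale H) sc (\<lambda>v. F (u, v))"
  shows "lin_ext sc F (comult H (x * y)) =
    lin_ext sc (\<lambda>(a, b). lin_ext sc (\<lambda>(c, d). F (a * c, b * d)) (comult H y)) (comult H x)"
proof -
  have vs: "vector_space sc"
    using lin1 by (simp add: Vector_Spaces.linear_def)
  show ?thesis
    unfolding lin_ext_eq_tensor2[OF lin1 lin2 comult_mult]
    by (simp add: linear_lin_ext_eq[OF linear_lin_ext[OF vs]] case_prod_unfold lin_ext_gen[OF vs])
qed

text \<open>The product S(g') g' is shown to be 1, and multiplying by g on the right gives the
  claim. For \<sigma> this computes \<open>inv (antipode H) \<sigma>\<close>, which enters the last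
  coface.\<close>

lemma antipode_inverse_group_like:
  assumes g: "group_like H g" and inv: "g * g' = 1" "g' * g = 1"
  shows "antipode H g' = g"
proof -
  interpret s: Vector_Spaces.linear "hscale H" "hscale H" "antipode H" by (rule antipode_linear)
  \<comment> \<open>This map satisfies F(1, 1) = S(g') g' and, as g' g = 1, F(g c, g d) = S(c) d,
    the term summed in the antipode axiom.\<close>
  define F where "F = (\<lambda>(a, b). antipode H (g' * a) * (g' * b))"
  have lin1: "Vector_Spaces.linear (hscale H) (hscale H) (\<lambda>u. F (u, v))" for v
    by (rule vector_space_linearI[OF vector_space_H vector_space_H]) (auto simp: F_def algebra_simps s.add s.scale scale_mult_left scale_mult_right)
  have lin2: "Vector_Spaces.linear (hscale H) (hscale H) (\<lambda>v. F (u, v))" for u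
    by (rule vector_space_linearI[OF vector_space_H vector_space_H]) (auto simp: F_def algebra_simps scale_mult_left scale_mult_right)
  have cancel: "g' * (g * c) = c" for c
    by (metis inv(2) mult.assoc mult_1_left)
  have "counit H g' = 1"
    using counit_mult[of g g'] g inv(1) by (simp add: group_like_def counit_one)
  txt \<open>Evaluating \<open>F(\<Delta>(g g'))\<close> through multiplicativity of \<open>\<Delta>\<close> avoids first proving that \<open>g'\<close> is group-like.\<close>
  have "antipode H g' * g' = F (1, 1)" by (simp add: F_def)
  also have "\<dots> = lin_ext (hscale H) F (comult H (g * g'))"
    unfolding inv(1)
    by (rule lin_ext_comult_group_like[symmetric, OF _ lin1 lin2])
       (simp add: group_like_def comult_one counit_one)
  also have "\<dots> = lin_ext (hscale H)
      (\<lambda>(a, b). lin_ext (hscale H) (\<lambda>(c, d). F (a * c, b * d)) (comult H g')) (comult H g)"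
    by (rule lin_ext_comult_mult[OF lin1 lin2])
  also have "\<dots> = (\<lambda>(a, b). lin_ext (hscale H) (\<lambda>(c, d). F (a * c, b * d)) (comult H g')) (g, g)"
    by (intro lin_ext_comult_group_like[OF g])
       (auto simp only: prod.case split_beta fst_conv snd_conv intro!: linear_lin_ext_family vector_space_H
          Vector_Spaces.linear_compose[OF linear_mult_left lin1, unfolded comp_def]
          Vector_Spaces.linear_compose[OF linear_mult_left lin2, unfolded comp_def])
  also have "\<dots> = lin_ext (hscale H) (\<lambda>(c, d). antipode H c * d) (comult H g')"
    by (simp add: F_def cancel)
  also have "\<dots> = 1" by (simp add: antipode_left \<open>counit H g' = 1\<close>)
  finally show ?thesis by (metis inv(2) mult.assoc mult_1_left mult_1_right)
qed

end


section \<open>Functionals on the cyclic nerve\<close>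

lemma fscale_gen_sum: "t = (\<Sum>x\<in>Poly_Mapping.keys t. fscale (Poly_Mapping.lookup t x) (gen x))"
proof (rule poly_mapping_eqI)
  fix y
  have "Poly_Mapping.lookup (\<Sum>x\<in>Poly_Mapping.keys t. fscale (Poly_Mapping.lookup t x) (gen x)) y =
      (\<Sum>x\<in>Poly_Mapping.keys t. if x = y then Poly_Mapping.lookup t x else 0)"
    unfolding lookup_sum
    by (intro sum.cong refl) (simp add: lookup_fscale gen_def lookup_single when_def)
  also have "\<dots> = Poly_Mapping.lookup t y"
    by (auto simp: sum.delta' in_keys_iff)
  finally show "Poly_Mapping.lookup t y =
      Poly_Mapping.lookup (\<Sum>x\<in>Poly_Mapping.keys t. fscale (Poly_Mapping.lookup t x) (gen x)) y" ..
qed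

interpretation free: vector_space fscale
  by (rule vector_space_fscale)

text \<open>The four clauses mirror the four families of generators of \<open>cn_relations\<close>,
  so this is the condition under which the linear extension of F descends to the quotient.\<close>

definition cn_multilinear ::
  "('k::field, 'h, 'o, 'm::ab_group_add) hcat \<Rightarrow> ('k, 'h, 'v::ab_group_add) mod_comod \<Rightarrow> nat \<Rightarrow>
   ('v \<times> 'o list \<times> 'm list \<Rightarrow> 'k) \<Rightarrow> bool" where
  "cn_multilinear D M n F \<longleftrightarrow>
     (\<forall>m m' Xs fs. (m, Xs, fs) \<in> cn_tuples D n \<longrightarrow> F (m + m', Xs, fs) = F (m, Xs, fs) + F (m', Xs, fs)) \<and>
     (\<forall>a m Xs fs. (m, Xs, fs) \<in> cn_tuples D n \<longrightarrow> F (vscale M a m, Xs, fs) = a * F (m, Xs, fs)) \<and>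
     (\<forall>m Xs fs i f f'. i \<le> n \<longrightarrow> (m, Xs, fs[i := f]) \<in> cn_tuples D n \<longrightarrow>
        (m, Xs, fs[i := f']) \<in> cn_tuples D n \<longrightarrow>
        F (m, Xs, fs[i := f + f']) = F (m, Xs, fs[i := f]) + F (m, Xs, fs[i := f'])) \<and>
     (\<forall>a m Xs fs i f. i \<le> n \<longrightarrow> (m, Xs, fs[i := f]) \<in> cn_tuples D n \<longrightarrow>
        F (m, Xs, fs[i := mscale D a f]) = a * F (m, Xs, fs[i := f]))"

lemma
  assumes "cn_multilinear D M n F"
  shows cn_multilinear_vscale:
      "(m, Xs, fs) \<in> cn_tuples D n \<Longrightarrow> F (vscale M a m, Xs, fs) = a * F (m, Xs, fs)"
    and cn_multilinear_add:
      "i \<le> n \<Longrightarrow> (m, Xs, fs[i := f]) \<in> cn_tuples D n \<Longrightarrow> (m, Xs, fs[i := f']) \<in> cn_tuples D n \<Longrightarrow>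
        F (m, Xs, fs[i := f + f']) = F (m, Xs, fs[i := f]) + F (m, Xs, fs[i := f'])"
    and cn_multilinear_mscale:
      "i \<le> n \<Longrightarrow> (m, Xs, fs[i := f]) \<in> cn_tuples D n \<Longrightarrow>
        F (m, Xs, fs[i := mscale D a f]) = a * F (m, Xs, fs[i := f])"
  using assms unfolding cn_multilinear_def by blast+

lemma lin_ext_cn_relations:
  assumes "cn_multilinear D M n F" "t \<in> cn_relations D M n"
  shows "lin_ext (*) F t = 0"
  using assms(2) unfolding cn_relations_def
proof (rule lin_ext_span_eq_0[OF vector_space_times], goal_cases)
  case (1 s)
  then show ?case
    using assms(1) unfolding cn_multilinear_def
    by (elim UnE CollectE exE conjE)
       (simp_all add: lin_ext_diff[OF vector_space_times] lin_ext_fscale[OF vector_space_times]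
          lin_ext_gen[OF vector_space_times])
qed

section \<open>Classes, their representatives, and functionals on the quotient\<close>

lemma cn_class_eq_iff: "cn_class D M n s = cn_class D M n t \<longleftrightarrow> s - t \<in> cn_relations D M n"
proof
  assume "cn_class D M n s = cn_class D M n t"
  moreover have "s \<in> cn_class D M n s"
    by (simp add: cn_class_def cn_relations_def free.span_zero)
  ultimately show "s - t \<in> cn_relations D M n" by (simp add: cn_class_def)
next
  assume st: "s - t \<in> cn_relations D M n"
  show "cn_class D M n s = cn_class D M n t"
    unfolding cn_class_def
  proof (intro Collect_cong iffI)
    fix u
    show "u - t \<in> cn_relations D M n" if "u - s \<in> cn_relations D M n"
      using free.span_add[OF that[unfolded cn_relations_def] st[unfolded cn_relations_def]]
      by (simp add: cn_relations_def)
    show "u - s \<in> cn_relations D M n" if "u - t \<in> cn_relations D M n"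
      using free.span_diff[OF that[unfolded cn_relations_def] st[unfolded cn_relations_def]]
      by (simp add: cn_relations_def)
  qed
qed

lemma some_cn_class: "(SOME s. s \<in> cn_class D M n t) - t \<in> cn_relations D M n"
proof -
  have "t \<in> cn_class D M n t"
    by (simp add: cn_class_def cn_relations_def free.span_zero)
  then have "(SOME s. s \<in> cn_class D M n t) \<in> cn_class D M n t"
    by (rule someI)
  then show ?thesis by (simp add: cn_class_def)
qed

text \<open>\<open>coface\<close> evaluates at a representative picked by \<open>SOME\<close>. It
  differs from t by a relation, which a multilinear F kills.\<close>

lemma lin_ext_some_cn_class:
  assumes "cn_multilinear D M n F"
  shows "lin_ext (*) F (SOME s. s \<in> cn_class D M n t) = lin_ext (*) F t"
  using lin_ext_cn_relations[OF assms some_cn_class[of D M n t]]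
  by (simp add: lin_ext_diff[OF vector_space_times])

lemma subspace_cn_free: "free.subspace (cn_free D n)"
proof (rule free.subspaceI)
  show "0 \<in> cn_free D n" by (simp add: cn_free_def)
  show "s + t \<in> cn_free D n" if "s \<in> cn_free D n" "t \<in> cn_free D n" for s t
    using that keys_add[of s t] by (auto simp: cn_free_def)
  show "fscale a t \<in> cn_free D n" if "t \<in> cn_free D n" for a t
    using that by (auto simp: cn_free_def in_keys_iff lookup_fscale)
qed

lemma gen_in_cn_free: "x \<in> cn_tuples D n \<Longrightarrow> gen x \<in> cn_free D n"
  by (simp add: cn_free_def gen_def)

context linear_category
begin

sublocale D: vector_space "mscale D" by (rule vector_space_D)

text \<open>Classes are cosets inside the space of all formal sums, not inside
  \<open>cn_free\<close>. As Hom spaces are subspaces, the relations involve composable tuples only,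
  so every representative of a class coming from \<open>cn_free\<close> lies in
  \<open>cn_free\<close>.\<close>

lemma cn_relations_subset_free: "cn_relations D M n \<subseteq> cn_free D n"
proof -
  have coeff: "(m', Xs, fs) \<in> cn_tuples D n" if "(m, Xs, fs) \<in> cn_tuples D n" for m m' Xs fs
    using that by (auto simp: cn_tuples_def)
  have add: "(m, Xs, fs[i := f + f']) \<in> cn_tuples D n"
    if "i \<le> n" "(m, Xs, fs[i := f]) \<in> cn_tuples D n" "(m, Xs, fs[i := f']) \<in> cn_tuples D n" for m Xs fs i f f'
    using that
    by (auto simp: cn_tuples_def nth_list_update all_set_conv_all_nth subset_iff
        intro!: D.subspace_add[OF subspace_Hom])
  have scale: "(m, Xs, fs[i := mscale D a f]) \<in> cn_tuples D n"
    if "i \<le> n" "(m, Xs, fs[i := f]) \<in> cn_tuples D n" for m Xs fs i a f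
    using that
    by (auto simp: cn_tuples_def nth_list_update all_set_conv_all_nth subset_iff
        intro!: D.subspace_scale[OF subspace_Hom])
  show ?thesis
    unfolding cn_relations_def
    by (rule free.span_minimal[OF _ subspace_cn_free])
       (auto intro!: free.subspace_diff free.subspace_scale subspace_cn_free gen_in_cn_free
         intro: coeff add scale)
qed

lemma some_cn_class_in_free: "t \<in> cn_free D n \<Longrightarrow> (SOME s. s \<in> cn_class D M n t) \<in> cn_free D n"
  using free.subspace_add[OF subspace_cn_free[of D n], of "(SOME s. s \<in> cn_class D M n t) - t" t]
    some_cn_class[of D M n t] cn_relations_subset_free[of M n] by auto

text \<open>Linearity of \<phi> is given only for classes of elements of \<open>cn_free\<close>, so
  the basis expansion of t is built up one key at a time, with every partial sum in
  \<open>cn_free\<close>.\<close>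

lemma cn_functional_eq_lin_ext:
  assumes \<phi>: "\<phi> \<in> cn_functionals D M n" and t: "t \<in> cn_free D n"
  shows "\<phi> (cn_class D M n t) = lin_ext (*) (\<lambda>x. \<phi> (cn_class D M n (gen x))) t"
proof -
  let ?s = "\<lambda>A. \<Sum>x\<in>A. fscale (Poly_Mapping.lookup t x) (gen x)"
  have "\<phi> (cn_class D M n (?s A)) = (\<Sum>x\<in>A. Poly_Mapping.lookup t x * \<phi> (cn_class D M n (gen x)))"
    if "finite A" "A \<subseteq> cn_tuples D n" for A
    using that
  proof (induction A rule: finite_induct)
    case empty
    \<comment> \<open>Homogeneity with scalar 0 shows that \<phi> vanishes on the class of the empty
      sum.\<close>
    have "\<phi> (cn_class D M n (fscale 0 0)) = 0 * \<phi> (cn_class D M n 0)"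
      using \<phi> free.subspace_0[OF subspace_cn_free, of D n] unfolding cn_functionals_def by blast
    then show ?case by simp
  next
    case (insert x A)
    let ?c = "Poly_Mapping.lookup t x"
    have A: "?s A \<in> cn_free D n" and x: "gen x \<in> cn_free D n"
      using insert.prems
      by (auto intro!: free.subspace_sum free.subspace_scale subspace_cn_free gen_in_cn_free)
    have "\<phi> (cn_class D M n (fscale ?c (gen x) + ?s A)) =
        \<phi> (cn_class D M n (fscale ?c (gen x))) + \<phi> (cn_class D M n (?s A))"
      using \<phi> A free.subspace_scale[OF subspace_cn_free x] unfolding cn_functionals_def by blast
    moreover have "\<phi> (cn_class D M n (fscale ?c (gen x))) = ?c * \<phi> (cn_class D M n (gen x))"
      using \<phi> x unfolding cn_functionals_def by blast
    ultimately show ?case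
      using insert by simp
  qed
  from this[of "Poly_Mapping.keys t"] t show ?thesis
    by (simp add: fscale_gen_sum[symmetric] cn_free_def lin_ext_def)
qed

text \<open>Each clause says that the linear extension of the values on pure tensors vanishes on a
  generator of \<open>cn_relations\<close>; it does, because such a generator has the class of
  0.\<close>

lemma cn_multilinear_pure:
  fixes M :: "('k, 'h, 'v::ab_group_add) mod_comod"
  assumes \<phi>: "\<phi> \<in> cn_functionals D M n"
  shows "cn_multilinear D M n (\<lambda>(m, Xs, fs). \<phi> (pure D M n m Xs fs))"
proof -
  let ?F = "\<lambda>x. \<phi> (cn_class D M n (gen x))"
  have kill: "lin_ext (*) ?F r = 0" if "r \<in> cn_relations D M n" for r
  proof -
    have "\<phi> (cn_class D M n r) = \<phi> (cn_class D M n 0)"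
      using that by (metis cn_class_eq_iff diff_zero)
    moreover have "r \<in> cn_free D n" "0 \<in> cn_free D n"
      using that cn_relations_subset_free free.subspace_0[OF subspace_cn_free] by blast+
    moreover have "lin_ext (*) ?F 0 = 0"
      by (simp add: lin_ext_def)
    ultimately show ?thesis
      using cn_functional_eq_lin_ext[OF \<phi>] by metis
  qed
  note simps = lin_ext_add[OF vector_space_times] lin_ext_diff[OF vector_space_times] lin_ext_fscale[OF vector_space_times]
    lin_ext_gen[OF vector_space_times]
  show ?thesis
    unfolding cn_multilinear_def pure_def prod.case
  proof (intro conjI allI impI)
    fix m m' :: 'v and Xs fs assume "(m, Xs, fs) \<in> cn_tuples D n"
    then have "gen (m + m', Xs, fs) - gen (m, Xs, fs) - gen (m', Xs, fs) \<in> cn_relations D M n"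
      unfolding cn_relations_def by (intro free.span_base) blast
    from kill[OF this] show "?F (m + m', Xs, fs) = ?F (m, Xs, fs) + ?F (m', Xs, fs)"
      by (simp add: simps algebra_simps)
  next
    fix a and m :: 'v and Xs fs assume "(m, Xs, fs) \<in> cn_tuples D n"
    then have "gen (vscale M a m, Xs, fs) - fscale a (gen (m, Xs, fs)) \<in> cn_relations D M n"
      unfolding cn_relations_def by (intro free.span_base) blast
    from kill[OF this] show "?F (vscale M a m, Xs, fs) = a * ?F (m, Xs, fs)"
      by (simp add: simps)
  next
    fix m :: 'v and Xs fs i f f'
    assume "i \<le> n" "(m, Xs, fs[i := f]) \<in> cn_tuples D n" "(m, Xs, fs[i := f']) \<in> cn_tuples D n"
    then have "gen (m, Xs, fs[i := f + f']) - gen (m, Xs, fs[i := f]) - gen (m, Xs, fs[i := f'])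
        \<in> cn_relations D M n"
      unfolding cn_relations_def by (intro free.span_base) blast
    from kill[OF this]
    show "?F (m, Xs, fs[i := f + f']) = ?F (m, Xs, fs[i := f]) + ?F (m, Xs, fs[i := f'])"
      by (simp add: simps algebra_simps)
  next
    fix a and m :: 'v and Xs fs i f assume "i \<le> n" "(m, Xs, fs[i := f]) \<in> cn_tuples D n"
    then have "gen (m, Xs, fs[i := mscale D a f]) - fscale a (gen (m, Xs, fs[i := f])) \<in> cn_relations D M n"
      unfolding cn_relations_def by (intro free.span_base) blast
    from kill[OF this] show "?F (m, Xs, fs[i := mscale D a f]) = a * ?F (m, Xs, fs[i := f])"
      by (simp add: simps)
  qed
qed

text \<open>Converse of \<open>cn_multilinear_pure\<close>: multilinear values on tuples come from a
  functional on the quotient, written in the same form as \<open>coface\<close>.\<close>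

lemma cn_functional_of_multilinear:
  assumes F: "cn_multilinear D M n F"
  defines "\<phi> \<equiv> (\<lambda>C\<in>cn_tensor D M n. lin_ext (*) F (SOME t. t \<in> C))"
  shows "\<phi> \<in> cn_functionals D M n"
    and "(m, Xs, fs) \<in> cn_tuples D n \<Longrightarrow> \<phi> (pure D M n m Xs fs) = F (m, Xs, fs)"
proof -
  have class_: "\<phi> (cn_class D M n t) = lin_ext (*) F t" if "t \<in> cn_free D n" for t
    using that by (simp add: \<phi>_def cn_tensor_def lin_ext_some_cn_class[OF F])
  show "\<phi> \<in> cn_functionals D M n"
    unfolding cn_functionals_def
  proof (intro CollectI conjI ballI allI)
    show "\<phi> \<in> extensional (cn_tensor D M n)" by (simp add: \<phi>_def)
    show "\<phi> (cn_class D M n (s + t)) = \<phi> (cn_class D M n s) + \<phi> (cn_class D M n t)"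
      if "s \<in> cn_free D n" "t \<in> cn_free D n" for s t
      using that free.subspace_add[OF subspace_cn_free that]
      by (simp add: class_ lin_ext_add[OF vector_space_times])
    show "\<phi> (cn_class D M n (fscale a t)) = a * \<phi> (cn_class D M n t)" if "t \<in> cn_free D n" for a t
      using that free.subspace_scale[OF subspace_cn_free that]
      by (simp add: class_ lin_ext_fscale[OF vector_space_times])
  qed
  show "\<phi> (pure D M n m Xs fs) = F (m, Xs, fs)" if "(m, Xs, fs) \<in> cn_tuples D n"
    using that by (simp add: pure_def class_ gen_in_cn_free lin_ext_gen[OF vector_space_times])
qed

lemma cn_functionals_eqI:
  assumes \<phi>: "\<phi> \<in> cn_functionals D M n" and \<psi>: "\<psi> \<in> cn_functionals D M n"
    and eq: "\<And>m Xs fs. (m, Xs, fs) \<in> cn_tuples D n \<Longrightarrow> \<phi> (pure D M n m Xs fs) = \<psi> (pure D M n m Xs fs)"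
  shows "\<phi> = \<psi>"
proof (rule extensionalityI)
  show "\<phi> \<in> extensional (cn_tensor D M n)" "\<psi> \<in> extensional (cn_tensor D M n)"
    using \<phi> \<psi> by (simp_all add: cn_functionals_def)
  fix C assume "C \<in> cn_tensor D M n"
  then obtain t where t: "t \<in> cn_free D n" "C = cn_class D M n t"
    by (auto simp: cn_tensor_def)
  have "lin_ext (*) (\<lambda>x. \<phi> (cn_class D M n (gen x))) t = lin_ext (*) (\<lambda>x. \<psi> (cn_class D M n (gen x))) t"
    using t(1) eq by (intro lin_ext_cong_keys) (auto simp: cn_free_def pure_def)
  then show "\<phi> C = \<psi> C"
    using t by (simp add: cn_functional_eq_lin_ext[OF \<phi>] cn_functional_eq_lin_ext[OF \<psi>])
qed

section \<open>Tuples and functionals in degrees zero and one\<close>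

lemma cn_tuples_0_iff:
  "(m, Xs, fs) \<in> cn_tuples D 0 \<longleftrightarrow> (\<exists>X\<in>Ob D. \<exists>f\<in>Hom D X X. Xs = [X] \<and> fs = [f])"
  by (auto simp: cn_tuples_def length_Suc_conv)

lemma ball_cn_tuples_0:
  "(\<forall>(m, Xs, fs)\<in>cn_tuples D 0. P m Xs fs) \<longleftrightarrow> (\<forall>m. \<forall>X\<in>Ob D. \<forall>f\<in>Hom D X X. P m [X] [f])"
  by (fastforce simp: cn_tuples_0_iff)

text \<open>The i-th morphism runs from X_{i+1} to X_i with indices modulo 2, so over [X, Y] the
  first entry is g : Y -> X and the second is f : X -> Y.\<close>

lemma cn_tuples_1_iff:
  "(m, Xs, fs) \<in> cn_tuples D 1 \<longleftrightarrow>
     (\<exists>X\<in>Ob D. \<exists>Y\<in>Ob D. \<exists>f\<in>Hom D X Y. \<exists>g\<in>Hom D Y X. Xs = [X, Y] \<and> fs = [g, f])"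
  by (auto simp: cn_tuples_def length_Suc_conv le_Suc_eq all_conj_distrib)

text \<open>With coefficients in k the function splits as m times B, and bilinearity of B in f and g
  is enough. Both coface values in degree 1 are treated this way.\<close>

lemma cn_multilinear_1I:
  fixes M :: "('k, 'h, 'k) mod_comod"
  assumes M: "vscale M = (*)"
    and F: "\<And>m X Y f g. X \<in> Ob D \<Longrightarrow> Y \<in> Ob D \<Longrightarrow> f \<in> Hom D X Y \<Longrightarrow> g \<in> Hom D Y X \<Longrightarrow>
      F (m, [X, Y], [g, f]) = m * B X Y g f"
    and B1: "\<And>X Y g. X \<in> Ob D \<Longrightarrow> Y \<in> Ob D \<Longrightarrow> g \<in> Hom D Y X \<Longrightarrow>
      (\<lambda>f\<in>Hom D X Y. B X Y g f) \<in> functionals_on (mscale D) (Hom D X Y)"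
    and B2: "\<And>X Y f. X \<in> Ob D \<Longrightarrow> Y \<in> Ob D \<Longrightarrow> f \<in> Hom D X Y \<Longrightarrow>
      (\<lambda>g\<in>Hom D Y X. B X Y g f) \<in> functionals_on (mscale D) (Hom D Y X)"
  shows "cn_multilinear D M 1 F"
proof -
  note closed = D.subspace_add[OF subspace_Hom] D.subspace_scale[OF subspace_Hom]
  have add_f: "B X Y g (f + f') = B X Y g f + B X Y g f'"
    if "X \<in> Ob D" "Y \<in> Ob D" "g \<in> Hom D Y X" "f \<in> Hom D X Y" "f' \<in> Hom D X Y" for X Y g f f'
    using B1[OF that(1-3)] that by (simp add: functionals_on_def closed)
  have scale_f: "B X Y g (mscale D a f) = a * B X Y g f"
    if "X \<in> Ob D" "Y \<in> Ob D" "g \<in> Hom D Y X" "f \<in> Hom D X Y" for X Y g f a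
    using B1[OF that(1-3)] that by (simp add: functionals_on_def closed)
  have add_g: "B X Y (g + g') f = B X Y g f + B X Y g' f"
    if "X \<in> Ob D" "Y \<in> Ob D" "f \<in> Hom D X Y" "g \<in> Hom D Y X" "g' \<in> Hom D Y X" for X Y f g g'
    using B2[OF that(1-3)] that by (simp add: functionals_on_def closed)
  have scale_g: "B X Y (mscale D a g) f = a * B X Y g f"
    if "X \<in> Ob D" "Y \<in> Ob D" "f \<in> Hom D X Y" "g \<in> Hom D Y X" for X Y f g a
    using B2[OF that(1-3)] that by (simp add: functionals_on_def closed)
  show ?thesis
    unfolding cn_multilinear_def cn_tuples_1_iff
  proof (intro conjI allI impI)
    fix m Xs fs i f f'
    assume "i \<le> 1" and f: "\<exists>X\<in>Ob D. \<exists>Y\<in>Ob D. \<exists>fa\<in>Hom D X Y. \<exists>g\<in>Hom D Y X. Xs = [X, Y] \<and> fs[i := f] = [g, fa]"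
      and f': "\<exists>X\<in>Ob D. \<exists>Y\<in>Ob D. \<exists>fa\<in>Hom D X Y. \<exists>g\<in>Hom D Y X. Xs = [X, Y] \<and> fs[i := f'] = [g, fa]"
    \<comment> \<open>The overwritten entry of \<open>fs\<close> is arbitrary, so the shape of
      \<open>fs\<close> is recovered from its length, which an update preserves; the index i then
      selects g or f.\<close>
    from f have "length fs = Suc (Suc 0)" by (metis length_Cons length_list_update list.size(3))
    then obtain p q where "fs = [p, q]" by (auto simp: length_Suc_conv)
    moreover have "i = 0 \<or> i = 1" using \<open>i \<le> 1\<close> by linarith
    ultimately show "F (m, Xs, fs[i := f + f']) = F (m, Xs, fs[i := f]) + F (m, Xs, fs[i := f'])"
      using f f' by (auto simp: F closed add_f add_g distrib_left)
  next
    fix a m Xs fs i f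
    assume "i \<le> 1" and f: "\<exists>X\<in>Ob D. \<exists>Y\<in>Ob D. \<exists>fa\<in>Hom D X Y. \<exists>g\<in>Hom D Y X. Xs = [X, Y] \<and> fs[i := f] = [g, fa]"
    from f have "length fs = Suc (Suc 0)" by (metis length_Cons length_list_update list.size(3))
    then obtain p q where "fs = [p, q]" by (auto simp: length_Suc_conv)
    moreover have "i = 0 \<or> i = 1" using \<open>i \<le> 1\<close> by linarith
    ultimately show "F (m, Xs, fs[i := mscale D a f]) = a * F (m, Xs, fs[i := f])"
      using f by (auto simp: F closed scale_f scale_g)
  qed (auto simp: F M distrib_right)
qed

text \<open>Homogeneity in the coefficient for m = m * 1: a functional is determined by its values
  at coefficient 1.\<close>

lemma cn_functional_pure_scale:
  fixes M :: "('k, 'h, 'k) mod_comod"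
  assumes "\<phi> \<in> cn_functionals D M 0" "vscale M = (*)" "X \<in> Ob D" "f \<in> Hom D X X"
  shows "\<phi> (pure D M 0 m [X] [f]) = m * \<phi> (pure D M 0 1 [X] [f])"
  using cn_multilinear_vscale[OF cn_multilinear_pure[OF assms(1)], of 1 "[X]" "[f]" m] assms(2-4)
  by (auto simp: cn_tuples_0_iff)

lemma functionals_on_pure:
  fixes M :: "('k, 'h, 'k) mod_comod"
  assumes "\<phi> \<in> cn_functionals D M 0" "X \<in> Ob D"
  shows "(\<lambda>f\<in>Hom D X X. \<phi> (pure D M 0 1 [X] [f])) \<in> functionals_on (mscale D) (Hom D X X)"
proof -
  have "\<phi> (pure D M 0 1 [X] [f + f']) = \<phi> (pure D M 0 1 [X] [f]) + \<phi> (pure D M 0 1 [X] [f'])"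
    if "f \<in> Hom D X X" "f' \<in> Hom D X X" for f f'
    \<comment> \<open>The entry of \<open>[0]\<close> is a placeholder that the update at index 0
      overwrites.\<close>
    using cn_multilinear_add[OF cn_multilinear_pure[OF assms(1)], of 0 1 "[X]" "[0]" f f'] assms(2) that
    by (auto simp: cn_tuples_0_iff)
  moreover have "\<phi> (pure D M 0 1 [X] [mscale D a f]) = a * \<phi> (pure D M 0 1 [X] [f])"
    if "f \<in> Hom D X X" for f a
    using cn_multilinear_mscale[OF cn_multilinear_pure[OF assms(1)], of 0 1 "[X]" "[0]" f a] assms(2) that
    by (auto simp: cn_tuples_0_iff)
  ultimately show ?thesis
    using D.subspace_add[OF subspace_Hom] D.subspace_scale[OF subspace_Hom] assms(2)
    by (simp add: functionals_on_def)
qed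

text \<open>The tensor product of k with CN_0 is the direct sum of the endomorphism spaces, and the
  dual of a direct sum is the product of the duals. The theorem restricts this bijection.\<close>

lemma bij_betw_cn_functionals_0:
  fixes M :: "('k, 'h, 'k) mod_comod"
  assumes M: "vscale M = (*)"
  shows "bij_betw (\<lambda>\<phi>. \<lambda>X\<in>Ob D. \<lambda>f\<in>Hom D X X. \<phi> (pure D M 0 1 [X] [f]))
    (cn_functionals D M 0) (\<Pi>\<^sub>E X\<in>Ob D. functionals_on (mscale D) (Hom D X X))"
  (is "bij_betw ?\<Theta> _ _")
proof (rule bij_betw_imageI)
  show "inj_on ?\<Theta> (cn_functionals D M 0)"
  proof (rule inj_onI)
    fix \<phi> \<psi> assume \<phi>: "\<phi> \<in> cn_functionals D M 0" and \<psi>: "\<psi> \<in> cn_functionals D M 0"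
      and eq: "?\<Theta> \<phi> = ?\<Theta> \<psi>"
    have "\<phi> (pure D M 0 1 [X] [f]) = \<psi> (pure D M 0 1 [X] [f])" if "X \<in> Ob D" "f \<in> Hom D X X" for X f
      using fun_cong[OF fun_cong[OF eq], of X f] that by simp
    then show "\<phi> = \<psi>"
      using cn_functional_pure_scale[OF \<phi> M] cn_functional_pure_scale[OF \<psi> M]
      by (intro cn_functionals_eqI[OF \<phi> \<psi>]) (metis cn_tuples_0_iff)
  qed
  show "?\<Theta> ` cn_functionals D M 0 = (\<Pi>\<^sub>E X\<in>Ob D. functionals_on (mscale D) (Hom D X X))"
  proof (intro equalityI subsetI)
    fix T assume "T \<in> ?\<Theta> ` cn_functionals D M 0"
    then show "T \<in> (\<Pi>\<^sub>E X\<in>Ob D. functionals_on (mscale D) (Hom D X X))"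
      using functionals_on_pure by auto
  next
    fix T assume T: "T \<in> (\<Pi>\<^sub>E X\<in>Ob D. functionals_on (mscale D) (Hom D X X))"
    \<comment> \<open>The preimage of T is the functional with these values; \<open>hd\<close> reads
      off the single object and the single morphism of a tuple of degree 0.\<close>
    define F where "F = (\<lambda>(m, Xs, fs). m * T (hd Xs) (hd fs))"
    define \<phi> where "\<phi> = (\<lambda>C\<in>cn_tensor D M 0. lin_ext (*) F (SOME t. t \<in> C))"
    have TX: "T X \<in> functionals_on (mscale D) (Hom D X X)" if "X \<in> Ob D" for X
      using T that by auto
    have upd: "fs[0 := f] = [g] \<longleftrightarrow> length fs = 1 \<and> f = g" for fs :: "'m list" and f g
      by (cases fs) auto
    have hd_upd: "hd (fs[0 := f]) = f" if "length fs = Suc 0" for fs :: "'m list" and f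
      using that by (cases fs) auto
    have "cn_multilinear D M 0 F"
      unfolding cn_multilinear_def
      using TX by (auto simp: cn_tuples_0_iff F_def M algebra_simps functionals_on_def upd hd_upd)
    note \<phi> = cn_functional_of_multilinear[OF this, folded \<phi>_def]
    have "?\<Theta> \<phi> X f = T X f" for X f
    proof (cases "X \<in> Ob D \<and> f \<in> Hom D X X")
      case True
      then show ?thesis by (simp add: \<phi>(2) cn_tuples_0_iff F_def)
    next
      \<comment> \<open>Off the domain the two sides agree because T and its components are
        extensional.\<close>
      case False
      then show ?thesis
        using T TX[of X] by (auto simp: functionals_on_def extensional_def PiE_def)
    qed
    then have "T = ?\<Theta> \<phi>" by (intro ext) simp
    with \<phi>(1) show "T \<in> ?\<Theta> ` cn_functionals D M 0" by blast
  qed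
qed

end


section \<open>Invariant traces\<close>

context left_H_category
begin

text \<open>As \<Delta>(\<sigma>) = \<sigma> \<otimes> \<sigma>, the Sweedler sum in
  \<open>act_cmp\<close> collapses to one term.\<close>

lemma act_cmp_group_like:
  assumes "group_like H \<sigma>" "X \<in> Ob D" "Y \<in> Ob D" "Z \<in> Ob D" "g \<in> Hom D Y Z" "f \<in> Hom D X Y"
  shows "act D X Z \<sigma> (cmp D X Y Z g f) = cmp D X Y Z (act D Y Z \<sigma> g) (act D X Y \<sigma> f)"
proof -
  have "lin_ext (mscale D) (\<lambda>(a, b). cmp D X Y Z (act D Y Z a g) (act D X Y b f)) (comult H \<sigma>) =
      (\<lambda>(a, b). cmp D X Y Z (act D Y Z a g) (act D X Y b f)) (\<sigma>, \<sigma>)"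
    using assms(2-6)
    by (intro lin_ext_comult_group_like[OF assms(1)];
        intro vector_space_linearI[OF vector_space_H vector_space_D])
       (simp_all add: act_H_add act_H_scale cmp_add_left cmp_add_right cmp_scale_left cmp_scale_right
          act_closed)
  then show ?thesis using assms(2-6) by (simp add: act_cmp)
qed

lemma functional_act_lin_ext:
  assumes T: "T \<in> functionals_on (mscale D) (Hom D X X)" and X: "X \<in> Ob D" and f: "f \<in> Hom D X X"
  shows "T (act D X X (lin_ext (hscale H) F t) f) = lin_ext (*) (\<lambda>x. T (act D X X (F x) f)) t"
proof (rule linear_lin_ext_eq)
  show "Vector_Spaces.linear (hscale H) (*) (\<lambda>h. T (act D X X h f))"
    using T X f
    by (intro vector_space_linearI vector_space_H vector_space_times)
       (auto simp: functionals_on_def act_H_add act_H_scale act_closed)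
qed

lemma invariant_iff_twisted_antipode:
  assumes mp: "modular_pair_in_involution H \<delta> \<sigma>"
    and T: "T \<in> functionals_on (mscale D) (Hom D X X)" and X: "X \<in> Ob D"
  shows "(\<forall>h. \<forall>f\<in>Hom D X X. T (act D X X (twisted_antipode H \<delta> h) f) = counit H h * T f) \<longleftrightarrow>
    (\<forall>h. \<forall>f\<in>Hom D X X. T (act D X X h f) = \<delta> h * T f)"
proof
  have \<delta>: "character H \<delta>" "Vector_Spaces.linear (hscale H) (*) \<delta>" "\<And>x y. \<delta> (x * y) = \<delta> x * \<delta> y" "\<delta> 1 = 1"
    and \<delta>\<sigma>: "\<delta> \<sigma> = 1"
    using mp by (auto simp: modular_pair_in_involution_def character_def)
  from mp obtain \<sigma>' where \<sigma>': "\<sigma> * \<sigma>' = 1" "\<sigma>' * \<sigma> = 1"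
    and inv: "\<And>h. twisted_antipode H \<delta> (twisted_antipode H \<delta> h) = \<sigma> * h * \<sigma>'"
    by (auto simp: modular_pair_in_involution_def)
  interpret d: Vector_Spaces.linear "hscale H" "(*)" \<delta> by (rule \<delta>(2))
  {
    assume *: "\<forall>h. \<forall>f\<in>Hom D X X. T (act D X X (twisted_antipode H \<delta> h) f) = counit H h * T f"
    show "\<forall>h. \<forall>f\<in>Hom D X X. T (act D X X h f) = \<delta> h * T f"
    proof (intro allI ballI)
      fix h f assume f: "f \<in> Hom D X X"
      \<comment> \<open>The twisted antipode applied twice to g gives back h. The assumption at
        \<open>twisted_antipode H \<delta> g\<close> then leaves the counit of that element, which
        is \<delta>(g), and \<delta>(g) = \<delta>(h) since \<delta> is 1 on \<sigma> and its
        inverse.\<close>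
      define g where "g = \<sigma>' * h * \<sigma>"
      have "\<sigma> * g * \<sigma>' = (\<sigma> * \<sigma>') * h * (\<sigma> * \<sigma>')"
        by (simp add: g_def mult.assoc)
      then have "h = twisted_antipode H \<delta> (twisted_antipode H \<delta> g)"
        by (simp add: \<sigma>' inv)
      then have "T (act D X X h f) = \<delta> g * T f"
        using * f by (simp add: counit_twisted_antipode[OF \<delta>(1)])
      moreover have "\<delta> \<sigma>' = 1"
        using \<delta>(3)[of \<sigma> \<sigma>'] by (simp add: \<sigma>' \<delta> \<delta>\<sigma>)
      ultimately show "T (act D X X h f) = \<delta> h * T f"
        by (simp add: g_def \<delta>(3) \<delta>\<sigma>)
    qed
  next
    assume *: "\<forall>h. \<forall>f\<in>Hom D X X. T (act D X X h f) = \<delta> h * T f"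
    \<comment> \<open>Multiplicativity gives \<delta>(h_1) \<delta>(S(h_2)) = \<delta>(h_1 S(h_2)),
      so the antipode axiom turns this into \<epsilon>(h).\<close>
    have "\<delta> (twisted_antipode H \<delta> h) = \<delta> (lin_ext (hscale H) (\<lambda>(a, b). a * antipode H b) (comult H h))" for h
      by (simp add: twisted_antipode_def linear_lin_ext_eq[OF \<delta>(2)] case_prod_unfold d.scale \<delta>(3))
    then have "\<delta> (twisted_antipode H \<delta> h) = counit H h" for h
      by (simp add: antipode_right d.scale \<delta>(4))
    with * show "\<forall>h. \<forall>f\<in>Hom D X X. T (act D X X (twisted_antipode H \<delta> h) f) = counit H h * T f"
      by simp
  }
qed

section \<open>The cochain and cocycle conditions in degree zero\<close>

lemma cochains_0_iff:
  fixes \<phi> :: "('k \<times> 'o list \<times> 'm list \<Rightarrow>\<^sub>0 'k) set \<Rightarrow> 'k"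
  assumes mp: "modular_pair_in_involution H \<delta> \<sigma>"
    and \<phi>: "\<phi> \<in> cn_functionals D (sigma_k_delta \<sigma> \<delta>) 0"
  shows "\<phi> \<in> cochains H D (sigma_k_delta \<sigma> \<delta>) 0 \<longleftrightarrow>
    (\<forall>X\<in>Ob D. \<forall>h. \<forall>f\<in>Hom D X X. \<phi> (pure D (sigma_k_delta \<sigma> \<delta>) 0 1 [X] [act D X X h f]) =
       \<delta> h * \<phi> (pure D (sigma_k_delta \<sigma> \<delta>) 0 1 [X] [f]))"
proof -
  let ?M = "sigma_k_delta \<sigma> \<delta>"
  define T where "T X = (\<lambda>f\<in>Hom D X X. \<phi> (pure D ?M 0 1 [X] [f]))" for X
  have M: "vscale ?M = (*)" "ract ?M = (\<lambda>\<alpha> h. \<delta> h * \<alpha>)" by (simp_all add: sigma_k_delta_def)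
  have T: "T X \<in> functionals_on (mscale D) (Hom D X X)" if "X \<in> Ob D" for X
    unfolding T_def by (rule functionals_on_pure[OF \<phi> that])
  have \<phi>_pure: "\<phi> (pure D ?M 0 m [X] [f]) = m * T X f" if "X \<in> Ob D" "f \<in> Hom D X X" for m X f
    using cn_functional_pure_scale[OF \<phi> M(1) that, of m] that by (simp add: T_def)
  \<comment> \<open>In degree 0 the iterated coproduct is trivial. The scalar \<delta>(h_1) from the
    action on k and S(h_2) acting on f combine into the twisted antipode.\<close>
  have eval: "lin_ext (*) (\<lambda>(h1, h2). lin_ext (*) (\<lambda>cs. \<phi> (pure D ?M 0 (ract ?M m h1) [X] (act_tuple D 0 [X] cs [f])))
      (iter_comult H 0 (antipode H h2))) (comult H h) = m * T X (act D X X (twisted_antipode H \<delta> h) f)"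
    if X: "X \<in> Ob D" and f: "f \<in> Hom D X X" for m X f h
  proof -
    have "T X (act D X X (hscale H a b) f) = a * T X (act D X X b f)" for a b
      using T[OF X] X f by (simp add: act_H_scale functionals_on_def act_closed)
    then have twisted: "T X (act D X X (twisted_antipode H \<delta> h) f) =
        lin_ext (*) (\<lambda>(a, b). \<delta> a * T X (act D X X (antipode H b) f)) (comult H h)"
      by (simp add: twisted_antipode_def functional_act_lin_ext[OF T[OF X] X f] case_prod_unfold)
    show ?thesis
      unfolding twisted
      using X f
      by (simp add: case_prod_unfold act_tuple_def M lin_ext_gen[OF vector_space_times] \<phi>_pure act_closed)
         (simp add: lin_ext_def sum_distrib_left mult.assoc mult.left_commute)
  qed
  have "\<phi> \<in> cochains H D ?M 0 \<longleftrightarrow> (\<forall>h m. \<forall>X\<in>Ob D. \<forall>f\<in>Hom D X X.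
      m * T X (act D X X (twisted_antipode H \<delta> h) f) = counit H h * (m * T X f))"
    using \<phi> unfolding cochains_def ball_cn_tuples_0 by (simp only: mem_Collect_eq simp_thms eval \<phi>_pure cong: ball_cong)
  also have "\<dots> \<longleftrightarrow> (\<forall>X\<in>Ob D. \<forall>h. \<forall>f\<in>Hom D X X.
      T X (act D X X (twisted_antipode H \<delta> h) f) = counit H h * T X f)"
    \<comment> \<open>The coefficient m = 1 recovers the unscaled identity.\<close>
    by (auto simp: mult.left_commute dest: spec[of _ 1])
  also have "\<dots> \<longleftrightarrow> (\<forall>X\<in>Ob D. \<forall>h. \<forall>f\<in>Hom D X X. T X (act D X X h f) = \<delta> h * T X f)"
    using invariant_iff_twisted_antipode[OF mp T] by blast
  finally show ?thesis by (simp add: T_def act_closed cong: ball_cong)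
qed

lemma coface_difference_0_iff:
  fixes \<phi> :: "('k \<times> 'o list \<times> 'm list \<Rightarrow>\<^sub>0 'k) set \<Rightarrow> 'k"
  assumes \<phi>: "\<phi> \<in> cn_functionals D (sigma_k_delta \<sigma> \<delta>) 0"
  shows "(\<forall>C\<in>cn_tensor D (sigma_k_delta \<sigma> \<delta>) 1.
      coface H D (sigma_k_delta \<sigma> \<delta>) 1 0 \<phi> C - coface H D (sigma_k_delta \<sigma> \<delta>) 1 1 \<phi> C = 0) \<longleftrightarrow>
    (\<forall>X\<in>Ob D. \<forall>Y\<in>Ob D. \<forall>f\<in>Hom D X Y. \<forall>g\<in>Hom D Y X.
      \<phi> (pure D (sigma_k_delta \<sigma> \<delta>) 0 1 [X] [cmp D X Y X g f]) =
      \<phi> (pure D (sigma_k_delta \<sigma> \<delta>) 0 1 [Y] [cmp D Y X Y (act D X Y (inv (antipode H) \<sigma>) f) g]))"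
  (is "?coface \<longleftrightarrow> ?trace")
proof -
  let ?M = "sigma_k_delta \<sigma> \<delta>" and ?\<tau> = "inv (antipode H) \<sigma>"
  define T where "T X = (\<lambda>f\<in>Hom D X X. \<phi> (pure D ?M 0 1 [X] [f]))" for X
  have M: "vscale ?M = (*)" "coact ?M = (\<lambda>\<alpha>. gen (\<sigma>, \<alpha>))" by (simp_all add: sigma_k_delta_def)
  have T: "T X \<in> functionals_on (mscale D) (Hom D X X)" if "X \<in> Ob D" for X
    unfolding T_def by (rule functionals_on_pure[OF \<phi> that])
  have \<phi>_pure: "\<phi> (pure D ?M 0 m [X] [f]) = m * T X f" if "X \<in> Ob D" "f \<in> Hom D X X" for m X f
    using cn_functional_pure_scale[OF \<phi> M(1) that, of m] that by (simp add: T_def)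
  \<comment> \<open>Coface 0 composes the two entries at X. Coface 1 moves f to the front, based at
    Y, twisted by the inverse antipode of \<sigma> because the coaction sends \<alpha> to \<sigma>
    \<otimes> \<alpha>.\<close>
  have value_0: "coface_value H D ?M 1 0 \<phi> (m, [X, Y], [g, f]) = m * T X (cmp D X Y X g f)"
    and value_1: "coface_value H D ?M 1 1 \<phi> (m, [X, Y], [g, f]) = m * T Y (cmp D Y X Y (act D X Y ?\<tau> f) g)"
    if "X \<in> Ob D" "Y \<in> Ob D" "f \<in> Hom D X Y" "g \<in> Hom D Y X" for m X Y f g
    using that by (simp_all add: coface_value_def M lin_ext_gen[OF vector_space_times] \<phi>_pure cmp_closed act_closed)
  have mult: "cn_multilinear D ?M 1 (coface_value H D ?M 1 i \<phi>)" if "i = 0 \<or> i = 1" for i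
    using that
  proof
    have T_add: "T X (f + f') = T X f + T X f'"
      if "X \<in> Ob D" "f \<in> Hom D X X" "f' \<in> Hom D X X" for X f f'
      using T[OF that(1)] that by (simp add: functionals_on_def)
    have T_scale: "T X (mscale D a f) = a * T X f" if "X \<in> Ob D" "f \<in> Hom D X X" for X f a
      using T[OF that(1)] that by (simp add: functionals_on_def)
    note simps = functionals_on_def T_add T_scale cmp_closed act_closed act_add act_scale
      cmp_add_left cmp_add_right cmp_scale_left cmp_scale_right
      D.subspace_add[OF subspace_Hom] D.subspace_scale[OF subspace_Hom]
    show "cn_multilinear D ?M 1 (coface_value H D ?M 1 i \<phi>)" if "i = 0"
      unfolding that by (rule cn_multilinear_1I[OF M(1) value_0]) (simp_all add: simps)
    show "cn_multilinear D ?M 1 (coface_value H D ?M 1 i \<phi>)" if "i = 1"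
      unfolding that by (rule cn_multilinear_1I[OF M(1) value_1]) (simp_all add: simps)
  qed
  show ?thesis
  proof
    assume ?coface
    show ?trace
    proof (intro ballI)
      fix X Y f g assume *: "X \<in> Ob D" "Y \<in> Ob D" "f \<in> Hom D X Y" "g \<in> Hom D Y X"
      let ?x = "(1, [X, Y], [g, f]) :: 'k \<times> 'o list \<times> 'm list"
      have x: "?x \<in> cn_tuples D 1" unfolding cn_tuples_1_iff using * by blast
      then have C: "cn_class D ?M 1 (gen ?x) \<in> cn_tensor D ?M 1"
        by (auto simp: cn_tensor_def intro!: gen_in_cn_free)
      \<comment> \<open>Multilinearity allows the chosen representative to be replaced by the
        generator itself.\<close>
      have eq: "coface H D ?M 1 i \<phi> (cn_class D ?M 1 (gen ?x)) = coface_value H D ?M 1 i \<phi> ?x"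
        if "i = 0 \<or> i = 1" for i
        using C unfolding coface_def
        by (simp add: lin_ext_some_cn_class[OF mult[OF that]] lin_ext_gen[OF vector_space_times]
            del: One_nat_def)
      from \<open>?coface\<close> C have "coface_value H D ?M 1 0 \<phi> ?x = coface_value H D ?M 1 1 \<phi> ?x"
        by (simp add: eq[of 0, symmetric] eq[of 1, symmetric] del: One_nat_def)
      then show "\<phi> (pure D ?M 0 1 [X] [cmp D X Y X g f]) =
          \<phi> (pure D ?M 0 1 [Y] [cmp D Y X Y (act D X Y ?\<tau> f) g])"
        using * by (simp add: value_0 value_1 \<phi>_pure cmp_closed act_closed del: One_nat_def)
    qed
  next
    assume trace: ?trace
    have eq: "coface_value H D ?M 1 0 \<phi> x = coface_value H D ?M 1 1 \<phi> x" if x: "x \<in> cn_tuples D 1" for x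
    proof -
      obtain m Xs fs where x': "x = (m, Xs, fs)" by (cases x)
      with x obtain X Y f g where *: "X \<in> Ob D" "Y \<in> Ob D" "f \<in> Hom D X Y" "g \<in> Hom D Y X"
        and "Xs = [X, Y]" "fs = [g, f]"
        unfolding x' cn_tuples_1_iff by blast
      moreover from trace * have "T X (cmp D X Y X g f) = T Y (cmp D Y X Y (act D X Y ?\<tau> f) g)"
        by (simp add: T_def cmp_closed act_closed)
      ultimately show ?thesis
        by (simp only: x' value_0 value_1)
    qed
    show ?coface
    proof
      fix C assume C: "C \<in> cn_tensor D ?M 1"
      then obtain t where "t \<in> cn_free D 1" "C = cn_class D ?M 1 t"
        by (auto simp: cn_tensor_def)
      \<comment> \<open>Both cofaces use the same representative, whose keys are composable tuples,
        so equality of the coface values on such tuples suffices.\<close>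
      then have "(SOME t. t \<in> C) \<in> cn_free D 1"
        using some_cn_class_in_free by blast
      then have "lin_ext (*) (coface_value H D ?M 1 0 \<phi>) (SOME t. t \<in> C) =
          lin_ext (*) (coface_value H D ?M 1 1 \<phi>) (SOME t. t \<in> C)"
        by (intro lin_ext_cong_keys eq) (auto simp: cn_free_def)
      with C show "coface H D ?M 1 0 \<phi> C - coface H D ?M 1 1 \<phi> C = 0"
        by (simp add: coface_def del: One_nat_def)
    qed
  qed
qed

lemma HC0_iff_invariant_sigma_traces:
  fixes \<phi> :: "('k \<times> 'o list \<times> 'm list \<Rightarrow>\<^sub>0 'k) set \<Rightarrow> 'k"
  assumes mp: "modular_pair_in_involution H \<delta> \<sigma>"
    and \<phi>: "\<phi> \<in> cn_functionals D (sigma_k_delta \<sigma> \<delta>) 0"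
  shows "\<phi> \<in> HC0 H D (sigma_k_delta \<sigma> \<delta>) \<longleftrightarrow>
    (\<lambda>X\<in>Ob D. \<lambda>f\<in>Hom D X X. \<phi> (pure D (sigma_k_delta \<sigma> \<delta>) 0 1 [X] [f])) \<in> invariant_sigma_traces D \<delta> \<sigma>"
    (is "_ \<longleftrightarrow> ?T \<in> _")
proof -
  let ?M = "sigma_k_delta \<sigma> \<delta>"
  from mp obtain \<sigma>' where \<sigma>': "\<sigma> * \<sigma>' = 1" "\<sigma>' * \<sigma> = 1" and \<sigma>: "group_like H \<sigma>" "\<delta> \<sigma> = 1"
    by (auto simp: modular_pair_in_involution_def)
  have inv: "inv (antipode H) \<sigma> = \<sigma>'"
    using antipode_inverse_group_like[OF \<sigma>(1) \<sigma>'] antipode_bij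
    by (metis bij_inv_eq_iff)
  have T_in: "?T \<in> (\<Pi>\<^sub>E X\<in>Ob D. functionals_on (mscale D) (Hom D X X))"
    using functionals_on_pure[OF \<phi>] by auto
  define T where "T = ?T"
  have cochain: "\<phi> \<in> cochains H D ?M 0 \<longleftrightarrow>
      (\<forall>X\<in>Ob D. \<forall>h. \<forall>f\<in>Hom D X X. T X (act D X X h f) = \<delta> h * T X f)"
    unfolding cochains_0_iff[OF mp \<phi>] T_def by (simp add: act_closed cong: ball_cong)
  let ?Inv = "\<forall>X\<in>Ob D. \<forall>h. \<forall>f\<in>Hom D X X. T X (act D X X h f) = \<delta> h * T X f"
  let ?Tr = "\<forall>X\<in>Ob D. \<forall>Y\<in>Ob D. \<forall>f\<in>Hom D X Y. \<forall>g\<in>Hom D Y X.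
    T X (cmp D X Y X g f) = T Y (cmp D Y X Y f (act D Y X \<sigma> g))"
  let ?Tr' = "\<forall>X\<in>Ob D. \<forall>Y\<in>Ob D. \<forall>f\<in>Hom D X Y. \<forall>g\<in>Hom D Y X.
    T X (cmp D X Y X g f) = T Y (cmp D Y X Y (act D X Y \<sigma>' f) g)"
  have "T X (cmp D X Y X g f) = T Y (cmp D Y X Y (act D X Y \<sigma>' f) g) \<longleftrightarrow>
      T X (cmp D X Y X g f) = T Y (cmp D Y X Y f (act D Y X \<sigma> g))"
    if inv_T: ?Inv
      and *: "X \<in> Ob D" "Y \<in> Ob D" "f \<in> Hom D X Y" "g \<in> Hom D Y X" for X Y f g
  proof -
    \<comment> \<open>Invariance and \<delta>(\<sigma>) = 1 allow \<sigma> to be inserted. Being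
      group-like, it acts on both factors and cancels \<sigma>' on f.\<close>
    have "T Y (cmp D Y X Y (act D X Y \<sigma>' f) g) = T Y (act D Y Y \<sigma> (cmp D Y X Y (act D X Y \<sigma>' f) g))"
      using inv_T * by (simp add: \<sigma>(2) cmp_closed act_closed)
    also have "act D Y Y \<sigma> (cmp D Y X Y (act D X Y \<sigma>' f) g) =
        cmp D Y X Y (act D X Y (\<sigma> * \<sigma>') f) (act D Y X \<sigma> g)"
      using * by (simp add: act_cmp_group_like[OF \<sigma>(1)] act_closed act_H_mult)
    finally show ?thesis using * by (simp add: \<sigma>' act_H_one)
  qed
  then have "?Inv \<Longrightarrow> ?Tr' \<longleftrightarrow> ?Tr"
    by (intro ball_cong refl)
  moreover have "(\<forall>C\<in>cn_tensor D ?M 1. coface H D ?M 1 0 \<phi> C - coface H D ?M 1 1 \<phi> C = 0) \<longleftrightarrow>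
      ?Tr'"
    unfolding coface_difference_0_iff[OF \<phi>] T_def inv by (simp add: act_closed cmp_closed cong: ball_cong)
  \<comment> \<open>The two trace conditions were matched under \<open>?Inv\<close>, which is
    exactly the cochain condition, so one may replace the other inside the conjunction.\<close>
  ultimately have "\<phi> \<in> HC0 H D ?M \<longleftrightarrow> ?Inv \<and> ?Tr"
    unfolding HC0_def mem_Collect_eq cochain by argo
  then have "\<phi> \<in> HC0 H D ?M \<longleftrightarrow> T \<in> invariant_sigma_traces D \<delta> \<sigma>"
    using T_in[folded T_def] unfolding invariant_sigma_traces_def sigma_traces_def mem_Collect_eq by argo
  then show ?thesis by (simp add: T_def)
qed

end

theorem proposition3p6:
  fixes H :: "('k::field_char_0, 'h::ring_1) hopf"
    and D :: "('k, 'h, 'o, 'm::ab_group_add) hcat"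
    and \<delta> :: "'h \<Rightarrow> 'k" and \<sigma> :: 'h
  assumes "left_H_category H D"
    and "modular_pair_in_involution H \<delta> \<sigma>"
  shows "bij_betw (\<lambda>\<phi>. \<lambda>X\<in>Ob D. \<lambda>f\<in>Hom D X X. \<phi> (pure D (sigma_k_delta \<sigma> \<delta>) 0 1 [X] [f]))
           (HC0 H D (sigma_k_delta \<sigma> \<delta>)) (invariant_sigma_traces D \<delta> \<sigma>)"
proof -
  interpret left_H_category H D by fact
  let ?M = "sigma_k_delta \<sigma> \<delta>"
  let ?\<Theta> = "\<lambda>\<phi>. \<lambda>X\<in>Ob D. \<lambda>f\<in>Hom D X X. \<phi> (pure D ?M 0 1 [X] [f])"
  \<comment> \<open>The bijection on all functionals is restricted: a trace has a preimage among the
    functionals, and the pointwise equivalence places it in \<open>HC0\<close>.\<close>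
  have "bij_betw ?\<Theta> (cn_functionals D ?M 0) (\<Pi>\<^sub>E X\<in>Ob D. functionals_on (mscale D) (Hom D X X))"
    by (rule bij_betw_cn_functionals_0) (simp add: sigma_k_delta_def)
  then have inj: "inj_on ?\<Theta> (cn_functionals D ?M 0)"
    and image: "?\<Theta> ` cn_functionals D ?M 0 = (\<Pi>\<^sub>E X\<in>Ob D. functionals_on (mscale D) (Hom D X X))"
    by (simp_all only: bij_betw_def)
  have HC0: "HC0 H D ?M \<subseteq> cn_functionals D ?M 0"
    by (auto simp: HC0_def cochains_def)
  have traces: "invariant_sigma_traces D \<delta> \<sigma> \<subseteq> (\<Pi>\<^sub>E X\<in>Ob D. functionals_on (mscale D) (Hom D X X))"
    by (auto simp: invariant_sigma_traces_def sigma_traces_def)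
  note iff = HC0_iff_invariant_sigma_traces[OF assms(2)]
  show ?thesis
  proof (rule bij_betw_imageI)
    show "inj_on ?\<Theta> (HC0 H D ?M)" by (rule inj_on_subset[OF inj HC0])
    show "?\<Theta> ` HC0 H D ?M = invariant_sigma_traces D \<delta> \<sigma>"
    proof (intro equalityI subsetI)
      fix T assume "T \<in> ?\<Theta> ` HC0 H D ?M"
      then show "T \<in> invariant_sigma_traces D \<delta> \<sigma>"
        using iff HC0 by blast
    next
      fix T assume T: "T \<in> invariant_sigma_traces D \<delta> \<sigma>"
      then obtain \<phi> where "\<phi> \<in> cn_functionals D ?M 0" "T = ?\<Theta> \<phi>"
        using traces image by blast
      with T show "T \<in> ?\<Theta> ` HC0 H D ?M"
        using iff by blast
    qed
  qed
qed

end
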